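(* Let $k\ge1$ and let $f:D\to\Lambda\times\mathbb{R}^u\times\mathbb{R}^s$ be a $C^{k+1}$ map satisfying the covering conditions, the rate conditions of order $k$ and the backward cone conditions (so that for each $z\in W^{cs}$ the stable fiber $W^s_z$ is the graph $\{(w^s_z(y),y):y\in\overline B_s(R)\}$ of a function $w^s_z:\overline B_s(R)\to\Lambda\times\overline B_u(R)$). Let $M\in(0,1/L)$ and $\mu=\sup_{z\in D}\{\|\partial f_y/\partial y(z)\|+M\|\partial f_y/\partial(\lambda,x)(z)\|\}$, $\xi=\inf_{z\in D}m([\partial f_{(\lambda,x)}/\partial(\lambda,x)(P(z))])-\frac1M\sup_{z\in D}\|\partial f_{(\lambda,x)}/\partial y(z)\|$. If $\xi/\mu>1$, then for every $z\in W^{cs}$ the function $w^s_z$ is Lipschitz with constant $M$.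
   Context: Setting. $c,u,s$ positive integers, $\Lambda=(\mathbb{R}/\mathbb{Z})^c$, $R_\Lambda=\tfrac12$. Points of $\Lambda$ are "in the same chart" if they have lifts to $\mathbb{R}^c$ at distance $\le R_\Lambda$; differences, norms, cones and derivatives are computed in such lifted coordinates; $\overline B_c(\lambda,R_\Lambda)$ is the closed ball of radius $R_\Lambda$ about a lift of $\lambda$. $B_n(R),\overline B_n(R)$: open/closed balls of radius $R$ at $0$ in $\mathbb{R}^n$; Euclidean norms. Fix $0<R<R_\Lambda/2$, $D=\Lambda\times\overline B_u(R)\times\overline B_s(R)$, points $z=(\lambda,x,y)$ with projections $\pi_\lambda,\pi_x,\pi_y,\pi_{(\lambda,x)},\pi_{(\lambda,y)}$; $f=(f_\lambda,f_x,f_y)$. $m(A)=\max\{c:\|Av\|\ge c\|v\|\ \forall v\}$, $m(\mathbf A)=\inf_{A\in\mathbf A}m(A)$ for a set of matrices; $[\partial g/\partial w(U)]$ is the set of matrices whose $(i,j)$ entry lies in $[\inf_U\partial g_i/\partial w_j,\sup_U\partial g_i/\partial w_j]$. $P(z)=\{w\in D:\|\pi_\lambda w-\pi_\lambda z\|\le R_\Lambda/2\}$. Fix $L\in(2R/R_\Lambda,1)$ and define $\mu_{s,1}=\sup_{D}\{\|\partial_y f_y\|+\frac1L\|\partial_{(\lambda,x)}f_y\|\}$, $\mu_{s,2}=\sup_D\{\|\partial_yf_y\|+L\|\partial_yf_{(\lambda,x)}\|\}$, $\xi_{u,1}=\inf_D\{m(\partial_xf_x)-\frac1L\|\partial_{(\lambda,y)}f_x\|\}$,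 $\xi_{u,1,P}=\inf_{z\in D}m[\partial_xf_x(P(z))]-\frac1L\sup_D\|\partial_{(\lambda,y)}f_x\|$, $\xi_{u,2}=\inf_D\{m(\partial_xf_x)-L\|\partial_xf_{(\lambda,y)}\|\}$, $\mu_{cs,1}=\sup_D\{\|\partial_{(\lambda,y)}f_{(\lambda,y)}\|+L\|\partial_xf_{(\lambda,y)}\|\}$, $\mu_{cs,2}=\sup_D\{\|\partial_{(\lambda,y)}f_{(\lambda,y)}\|+\frac1L\|\partial_{(\lambda,y)}f_x\|\}$, $\xi_{cu,1}=\inf_D\{m(\partial_{(\lambda,x)}f_{(\lambda,x)})-L\|\partial_yf_{(\lambda,x)}\|\}$, $\xi_{cu,1,P}=\inf_{z\in D}m[\partial_{(\lambda,x)}f_{(\lambda,x)}(P(z))]-L\sup_D\|\partial_yf_{(\lambda,x)}\|$, $\xi_{cu,2}=\inf_D\{m(\partial_{(\lambda,x)}f_{(\lambda,x)})-\frac1L\|\partial_{(\lambda,x)}f_y\|\}$. Rate conditions of order $k$: all $\xi$'s above positive, $\mu_{s,1}<1<\xi_{u,1,P}$, $\mu_{cs,1}<\xi_{u,1,P}$, $\mu_{s,1}<\xi_{cu,1,P}$, and for $1\le j\le k$: $\mu_{cs,1}^{j+1}<\xi_{u,2}$, $\mu_{s,2}<\xi_{cu,1}^{j+1}$; and $\mu_{cs,2}<\xi_{u,1}$, $\mu_{s,1}<\xi_{cu,2}$. Cones: $J_s(z,M)=\{\|(\lambda,x)-\pi_{(\lambda,x)}z\|\le M\|y-\pi_yz\|\}$,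 $J_u(z,M)=\{\|(\lambda,y)-\pi_{(\lambda,y)}z\|\le M\|x-\pi_xz\|\}$. $W^{cs}=\{z:f^n(z)\in D\ \forall n\ge0\}$; for $z\in W^{cs}$, $W^s_z=\{p\in D:f^n(p)\in J_s(f^n(z),1/L)\cap D\ \forall n\ge0\}$. Backward cone conditions: if $z_1,z_2,f(z_1),f(z_2)\in D$ and $f(z_1)\in J_s(f(z_2),1/L)$ then $z_1\in J_s(z_2,1/L)$. Covering conditions: with $D_\lambda=\overline B_c(\lambda,R_\Lambda)\times\overline B_u(R)\times\overline B_s(R)$, $D^+_\lambda=\overline B_c(\lambda,R_\Lambda)\times\overline B_u(R)\times\partial B_s(R)$, $D^-_\lambda=\overline B_c(\lambda,R_\Lambda)\times\partial B_u(R)\times B_s(R)$: for every $z\in D$ there exist $\lambda^*$, a homotopy $h:[0,1]\times U\to B_c(\lambda^*,R_\Lambda)\times\mathbb{R}^u\times\mathbb{R}^s$, $U=J_u(z,1/L)\cap D$, and linear $A$ on $\mathbb{R}^u$ with $h_0=f|_U$, $h_\alpha(U\cap D^-_{\pi_\lambda z})\cap D_{\lambda^*}=\emptyset$, $h_\alpha(U)\cap D^+_{\lambda^*}=\emptyset$ for all $\alpha$, $h_1(\lambda,x,y)=(\lambda^*,Ax,0)$, $A(\partial B_u(R))\subset\mathbb{R}^u\setminus\overline B_u(R)$. *)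

theory Defs
  imports "HOL-Analysis.Analysis"
begin

text \<open>
Encoding.  The torus Lambda = (R/Z)^c is represented through lifts: a point
z = (lambda,x,y) of D is represented by any (l,x,y) in R^c x R^u x R^s
with l a lift of lambda.  The map f is represented by a lift F
(defined on the lifted domain) which is compatible with integer translations
in the lambda coordinate.  R_Lambda = 1/2 throughout.
\<close>

type_synonym ('c,'u,'s) pt = "(real^'c) \<times> (real^'u) \<times> (real^'s)"

definition RLam :: real where "RLam = 1/2"

definition lam :: "('c::finite,'u::finite,'s::finite) pt \<Rightarrow> real^'c" where "lam p = fst p"
definition xc :: "('c::finite,'u::finite,'s::finite) pt \<Rightarrow> real^'u" where "xc p = fst (snd p)"
definition yc :: "('c::finite,'u::finite,'s::finite) pt \<Rightarrow> real^'s" where "yc p = snd (snd p)"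
definition lx :: "('c::finite,'u::finite,'s::finite) pt \<Rightarrow> (real^'c) \<times> (real^'u)" where "lx p = (fst p, fst (snd p))"
definition ly :: "('c::finite,'u::finite,'s::finite) pt \<Rightarrow> (real^'c) \<times> (real^'s)" where "ly p = (fst p, snd (snd p))"

definition intvec :: "real^'c::finite \<Rightarrow> bool" where "intvec v \<longleftrightarrow> (\<forall>i. v $ i \<in> \<int>)"

definition shiftl :: "real^'c::finite \<Rightarrow> ('c,'u::finite,'s::finite) pt \<Rightarrow> ('c,'u,'s) pt"
  where "shiftl n p = (fst p + n, snd p)"

text \<open>Two lifted points represent the same point of Lambda x R^u x R^s.\<close>
definition teq :: "('c::finite,'u::finite,'s::finite) pt \<Rightarrow> ('c,'u,'s) pt \<Rightarrow> bool"
  where "teq p q \<longleftrightarrow> intvec (lam p - lam q) \<and> xc p = xc q \<and> yc p = yc q"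

definition tdist :: "(real^'c::finite) \<times> (real^'u::finite) \<Rightarrow> (real^'c) \<times> (real^'u) \<Rightarrow> real"
  where "tdist a b = Inf {norm (fst a - fst b + n, snd a - snd b) | n. intvec n}"

definition tdistc :: "real^'c::finite \<Rightarrow> real^'c \<Rightarrow> real"
  where "tdistc a b = Inf {norm (a - b + n) | n. intvec n}"

definition Dl :: "real \<Rightarrow> ('c::finite,'u::finite,'s::finite) pt set"
  where "Dl R = UNIV \<times> cball 0 R \<times> cball 0 R"

definition Pset :: "real \<Rightarrow> ('c::finite,'u::finite,'s::finite) pt \<Rightarrow> ('c,'u,'s) pt set"
  where "Pset R z = {w \<in> Dl R. tdistc (lam w) (lam z) \<le> RLam / 2}"

definition Js_chart :: "('c::finite,'u::finite,'s::finite) pt \<Rightarrow> real \<Rightarrow> ('c,'u,'s) pt set"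
  where "Js_chart z M = {w. norm (lam w - lam z) \<le> RLam \<and>
           norm (lx w - lx z) \<le> M * norm (yc w - yc z)}"

definition Ju_chart :: "('c::finite,'u::finite,'s::finite) pt \<Rightarrow> real \<Rightarrow> ('c,'u,'s) pt set"
  where "Ju_chart z M = {w. norm (lam w - lam z) \<le> RLam \<and>
           norm (ly w - ly z) \<le> M * norm (xc w - xc z)}"

text \<open>The cone J_s(z,M) as a set of torus points: all lifts of points in it.\<close>
definition Js :: "('c::finite,'u::finite,'s::finite) pt \<Rightarrow> real \<Rightarrow> ('c,'u,'s) pt set"
  where "Js z M = {w. \<exists>n. intvec n \<and> shiftl n w \<in> Js_chart z M}"

definition is_lift_map :: "real \<Rightarrow> (('c::finite,'u::finite,'s::finite) pt \<Rightarrow> ('c,'u,'s) pt) \<Rightarrow> bool"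
  where "is_lift_map R F \<longleftrightarrow> (\<forall>p\<in>Dl R. \<forall>n. intvec n \<longrightarrow> teq (F (shiftl n p)) (F p))"

definition pdiff :: "'a::euclidean_space \<Rightarrow> ('a \<Rightarrow> 'b::real_normed_vector) \<Rightarrow> 'a \<Rightarrow> 'b"
  where "pdiff v g p = vector_derivative (\<lambda>t. g (p + t *\<^sub>R v)) (at 0)"

fun iter_pd :: "'a::euclidean_space list \<Rightarrow> ('a \<Rightarrow> 'b::real_normed_vector) \<Rightarrow> 'a \<Rightarrow> 'b" where
  "iter_pd [] g = g"
| "iter_pd (v # vs) g = pdiff v (iter_pd vs g)"

definition Ck_on :: "nat \<Rightarrow> ('a::euclidean_space \<Rightarrow> 'b::real_normed_vector) \<Rightarrow> 'a set \<Rightarrow> bool"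
  where "Ck_on n g S \<longleftrightarrow> open S \<and>
     (\<forall>vs. set vs \<subseteq> Basis \<and> length vs \<le> n \<longrightarrow> continuous_on S (iter_pd vs g)) \<and>
     (\<forall>vs. set vs \<subseteq> Basis \<and> length vs < n \<longrightarrow>
        (\<forall>v\<in>Basis. \<forall>p\<in>S. (\<lambda>t. iter_pd vs g (p + t *\<^sub>R v)) differentiable (at 0)))"

definition DF :: "(('c::finite,'u::finite,'s::finite) pt \<Rightarrow> ('c,'u,'s) pt) \<Rightarrow> ('c,'u,'s) pt \<Rightarrow> ('c,'u,'s) pt \<Rightarrow> ('c,'u,'s) pt"
  where "DF F p = frechet_derivative F (at p)"

definition in_y :: "real^'s \<Rightarrow> ('c::finite,'u::finite,'s::finite) pt" where "in_y v = (0, 0, v)"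
definition in_x :: "real^'u \<Rightarrow> ('c::finite,'u::finite,'s::finite) pt" where "in_x v = (0, v, 0)"
definition in_lx :: "(real^'c) \<times> (real^'u) \<Rightarrow> ('c::finite,'u::finite,'s::finite) pt" where "in_lx v = (fst v, snd v, 0)"
definition in_ly :: "(real^'c) \<times> (real^'s) \<Rightarrow> ('c::finite,'u::finite,'s::finite) pt" where "in_ly v = (fst v, 0, snd v)"

definition dyfy where "dyfy F p = yc \<circ> DF F p \<circ> in_y"
definition dlxfy where "dlxfy F p = yc \<circ> DF F p \<circ> in_lx"
definition dyflx where "dyflx F p = lx \<circ> DF F p \<circ> in_y"
definition dxfx where "dxfx F p = xc \<circ> DF F p \<circ> in_x"
definition dlyfx where "dlyfx F p = xc \<circ> DF F p \<circ> in_ly"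
definition dxfly where "dxfly F p = ly \<circ> DF F p \<circ> in_x"
definition dlyfly where "dlyfly F p = ly \<circ> DF F p \<circ> in_ly"
definition dlxflx where "dlxflx F p = lx \<circ> DF F p \<circ> in_lx"

definition mnorm :: "('a::real_normed_vector \<Rightarrow> 'b::real_normed_vector) \<Rightarrow> real"
  where "mnorm A = Sup {c. \<forall>v. c * norm v \<le> norm (A v)}"

text \<open>Interval matrix [dg/dw(U)] (matrices as linear maps, entries w.r.t. the standard bases).\<close>
definition ivmat :: "('p \<Rightarrow> 'a::euclidean_space \<Rightarrow> 'b::euclidean_space) \<Rightarrow> 'p set \<Rightarrow> ('a \<Rightarrow> 'b) set"
  where "ivmat G U = {A. linear A \<and> (\<forall>i\<in>Basis. \<forall>j\<in>Basis.
           Inf {G p j \<bullet> i | p. p \<in> U} \<le> A j \<bullet> i \<and> A j \<bullet> i \<le> Sup {G p j \<bullet> i | p. p \<in> U})}"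

definition m_set :: "('a::real_normed_vector \<Rightarrow> 'b::real_normed_vector) set \<Rightarrow> real"
  where "m_set S = Inf (mnorm ` S)"

definition supD :: "real \<Rightarrow> (('c::finite,'u::finite,'s::finite) pt \<Rightarrow> real) \<Rightarrow> real"
  where "supD R g = (SUP p\<in>Dl R. g p)"
definition infD :: "real \<Rightarrow> (('c::finite,'u::finite,'s::finite) pt \<Rightarrow> real) \<Rightarrow> real"
  where "infD R g = (INF p\<in>Dl R. g p)"

definition mu_s1 where "mu_s1 R L F = supD R (\<lambda>p. onorm (dyfy F p) + 1/L * onorm (dlxfy F p))"
definition mu_s2 where "mu_s2 R L F = supD R (\<lambda>p. onorm (dyfy F p) + L * onorm (dyflx F p))"
definition xi_u1 where "xi_u1 R L F = infD R (\<lambda>p. mnorm (dxfx F p) - 1/L * onorm (dlyfx F p))"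
definition xi_u1P where "xi_u1P R L F =
   infD R (\<lambda>z. m_set (ivmat (dxfx F) (Pset R z))) - 1/L * supD R (\<lambda>p. onorm (dlyfx F p))"
definition xi_u2 where "xi_u2 R L F = infD R (\<lambda>p. mnorm (dxfx F p) - L * onorm (dxfly F p))"
definition mu_cs1 where "mu_cs1 R L F = supD R (\<lambda>p. onorm (dlyfly F p) + L * onorm (dxfly F p))"
definition mu_cs2 where "mu_cs2 R L F = supD R (\<lambda>p. onorm (dlyfly F p) + 1/L * onorm (dlyfx F p))"
definition xi_cu1 where "xi_cu1 R L F = infD R (\<lambda>p. mnorm (dlxflx F p) - L * onorm (dyflx F p))"
definition xi_cu1P where "xi_cu1P R L F =
   infD R (\<lambda>z. m_set (ivmat (dlxflx F) (Pset R z))) - L * supD R (\<lambda>p. onorm (dyflx F p))"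
definition xi_cu2 where "xi_cu2 R L F = infD R (\<lambda>p. mnorm (dlxflx F p) - 1/L * onorm (dlxfy F p))"

definition rate_conditions :: "nat \<Rightarrow> real \<Rightarrow> real \<Rightarrow> (('c::finite,'u::finite,'s::finite) pt \<Rightarrow> ('c,'u,'s) pt) \<Rightarrow> bool"
  where "rate_conditions k R L F \<longleftrightarrow>
    xi_u1 R L F > 0 \<and> xi_u1P R L F > 0 \<and> xi_u2 R L F > 0 \<and>
    xi_cu1 R L F > 0 \<and> xi_cu1P R L F > 0 \<and> xi_cu2 R L F > 0 \<and>
    mu_s1 R L F < 1 \<and> 1 < xi_u1P R L F \<and>
    mu_cs1 R L F < xi_u1P R L F \<and> mu_s1 R L F < xi_cu1P R L F \<and>
    (\<forall>j\<in>{1..k}. mu_cs1 R L F ^ (j+1) < xi_u2 R L F \<and> mu_s2 R L F < xi_cu1 R L F ^ (j+1)) \<and>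
    mu_cs2 R L F < xi_u1 R L F \<and> mu_s1 R L F < xi_cu2 R L F"

definition backward_cone_conditions :: "real \<Rightarrow> real \<Rightarrow> (('c::finite,'u::finite,'s::finite) pt \<Rightarrow> ('c,'u,'s) pt) \<Rightarrow> bool"
  where "backward_cone_conditions R L F \<longleftrightarrow>
    (\<forall>z1\<in>Dl R. \<forall>z2\<in>Dl R. F z1 \<in> Dl R \<and> F z2 \<in> Dl R \<and> F z1 \<in> Js (F z2) (1/L)
        \<longrightarrow> z1 \<in> Js z2 (1/L))"

text \<open>Covering conditions.  U = J_u(z,1/L) \<inter> D is represented by its lifts in the
chart around the lift z; h takes values in the chart B_c(lambda*,R_Lambda) x R^u x R^s.\<close>
definition covering_conditions :: "real \<Rightarrow> real \<Rightarrow> (('c::finite,'u::finite,'s::finite) pt \<Rightarrow> ('c,'u,'s) pt) \<Rightarrow> bool"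
  where "covering_conditions R L F \<longleftrightarrow>
    (\<forall>z\<in>Dl R. \<exists>lst::real^'c. \<exists>h::real \<Rightarrow> ('c,'u,'s) pt \<Rightarrow> ('c,'u,'s) pt. \<exists>A::real^'u \<Rightarrow> real^'u.
       (let U = Ju_chart z (1/L) \<inter> Dl R in
         continuous_on ({0..1} \<times> U) (\<lambda>(a,w). h a w) \<and>
         (\<forall>a\<in>{0..1}. \<forall>w\<in>U. h a w \<in> ball lst RLam \<times> UNIV \<times> UNIV) \<and>
         (\<forall>w\<in>U. teq (h 0 w) (F w)) \<and>
         (\<forall>a\<in>{0..1}. \<forall>w\<in>U.
             (lam w \<in> cball (lam z) RLam \<and> xc w \<in> sphere 0 R \<and> yc w \<in> ball 0 R) \<longrightarrow>
             h a w \<notin> cball lst RLam \<times> cball 0 R \<times> cball 0 R) \<and>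
         (\<forall>a\<in>{0..1}. \<forall>w\<in>U. h a w \<notin> cball lst RLam \<times> cball 0 R \<times> sphere 0 R) \<and>
         (\<forall>w\<in>U. h 1 w = (lst, A (xc w), 0)) \<and>
         linear A \<and>
         A ` sphere 0 R \<subseteq> - cball 0 R))"

definition Wcs :: "real \<Rightarrow> (('c::finite,'u::finite,'s::finite) pt \<Rightarrow> ('c,'u,'s) pt) \<Rightarrow> ('c,'u,'s) pt set"
  where "Wcs R F = {z. \<forall>n. (F ^^ n) z \<in> Dl R}"

definition Ws :: "real \<Rightarrow> real \<Rightarrow> (('c::finite,'u::finite,'s::finite) pt \<Rightarrow> ('c,'u,'s) pt) \<Rightarrow> ('c,'u,'s) pt \<Rightarrow> ('c,'u,'s) pt set"
  where "Ws R L F z = {p \<in> Dl R. \<forall>n. (F ^^ n) p \<in> Js ((F ^^ n) z) (1/L) \<inter> Dl R}"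

end

theory Submission
  imports Defs
begin

text \<open>
  Fix \<open>z\<close> with forward orbit in \<open>D\<close>. A disc is an \<open>M\<close>-Lipschitz graph of \<open>(\<lambda>, x)\<close> over the whole \<open>y\<close>-ball.
  The assumption \<open>\<xi> / \<mu> > 1\<close> makes \<open>M\<close>-cones backward invariant, so the preimage under \<open>f\<close> of a disc through
  \<open>f z\<close> contains a disc through \<open>z\<close>: preimages are continued in \<open>y\<close>, starting from \<open>z\<close>, and the covering
  condition prevents them from leaving \<open>D\<close> (only its boundary part is used, no degree theory).
  Pulling the constant disc through \<open>f\<^sup>n z\<close> back to \<open>z\<close> and letting \<open>n\<close> tend to infinity yields points of
  \<open>W\<^sup>s\<^sub>z\<close> over every \<open>y\<close>, pairwise \<open>M\<close>-Lipschitz. Uniqueness over each \<open>y\<close> holds because two distinct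
  such points would, by the backward cone condition, separate faster than \<open>W\<^sup>s\<^sub>z\<close> contracts.
\<close>

subsection \<open>Strict differentiability from continuous partial derivatives\<close>

text \<open>The cone and expansion estimates hold only for two lifts in one chart. The room for this
  comes from \<open>2 * R * M < RLam\<close>, a consequence of M < 1/L and 2R/\<open>RLam\<close> <
  L: points of D in the M-cone of one another lie strictly inside a common chart, and the surplus
  pays for the step length with which distant preimages are compared. A second obstacle is that the
  lifted domain is unbounded in \<lambda>, so the suprema in the rate conditions are informative
  only once periodicity has bounded the derivative of the lift. A third is that preimages are
  continued in a closed domain, possibly over its y-boundary: openness is obtained in the open set
  on which the lift is smooth, for an extended disc, and strict a priori bounds bring the solutions
  back into D.\<close>

lemma pdiff_along_line:
  fixes f :: "'a::euclidean_space \<Rightarrow> 'b::real_normed_vector"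
  assumes "(\<lambda>s. f ((q + t *\<^sub>R v) + s *\<^sub>R v)) differentiable (at 0)"
  shows "((\<lambda>s. f (q + s *\<^sub>R v)) has_vector_derivative pdiff v f (q + t *\<^sub>R v)) (at t within T)"
proof -
  have "((\<lambda>s. f ((q + t *\<^sub>R v) + s *\<^sub>R v)) has_vector_derivative pdiff v f (q + t *\<^sub>R v)) (at 0)"
    using assms unfolding pdiff_def by (simp add: vector_derivative_works)
  then have "((\<lambda>s. f ((q + t *\<^sub>R v) + s *\<^sub>R v)) has_derivative (\<lambda>s. s *\<^sub>R pdiff v f (q + t *\<^sub>R v))) (at (t - t))"
    by (simp add: has_vector_derivative_def)
  moreover have "((\<lambda>s. s - t) has_derivative (\<lambda>s. s)) (at t)"
    by (auto intro!: derivative_eq_intros)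
  ultimately have "((\<lambda>s. f ((q + t *\<^sub>R v) + (s - t) *\<^sub>R v)) has_derivative (\<lambda>s. s *\<^sub>R pdiff v f (q + t *\<^sub>R v))) (at t)"
    by (rule has_derivative_compose[rotated])
  then show ?thesis
    by (simp add: has_vector_derivative_def algebra_simps has_derivative_at_withinI)
qed

lemma Ck_on_mono: "Ck_on n f S \<Longrightarrow> m \<le> n \<Longrightarrow> Ck_on m f S"
  unfolding Ck_on_def by (meson le_trans less_le_trans)

lemma Ck_on_1D:
  assumes "Ck_on 1 f S"
  shows "open S" "continuous_on S f" "v \<in> Basis \<Longrightarrow> continuous_on S (pdiff v f)"
    "v \<in> Basis \<Longrightarrow> p \<in> S \<Longrightarrow> (\<lambda>t. f (p + t *\<^sub>R v)) differentiable (at 0)"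
proof -
  have 1: "open S" and 2: "\<And>vs. set vs \<subseteq> Basis \<Longrightarrow> length vs \<le> 1 \<Longrightarrow> continuous_on S (iter_pd vs f)"
    and 3: "\<And>vs v p. set vs \<subseteq> Basis \<Longrightarrow> length vs < 1 \<Longrightarrow> v \<in> Basis \<Longrightarrow> p \<in> S \<Longrightarrow>
       (\<lambda>t. iter_pd vs f (p + t *\<^sub>R v)) differentiable (at 0)"
    using assms unfolding Ck_on_def by blast+
  show "open S" by fact
  show "continuous_on S f" using 2[of "[]"] by simp
  show "v \<in> Basis \<Longrightarrow> continuous_on S (pdiff v f)" using 2[of "[v]"] by simp
  show "v \<in> Basis \<Longrightarrow> p \<in> S \<Longrightarrow> (\<lambda>t. f (p + t *\<^sub>R v)) differentiable (at 0)" using 3[of "[]"] by simp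
qed

definition jac :: "('a::euclidean_space \<Rightarrow> 'b::real_normed_vector) \<Rightarrow> 'a \<Rightarrow> 'a \<Rightarrow> 'b"
  where "jac f p h = (\<Sum>v\<in>Basis. (h \<bullet> v) *\<^sub>R pdiff v f p)"

lemma linear_jac: "linear (jac f p)"
  by (rule linearI) (simp_all add: jac_def inner_left_distrib scaleR_left_distrib sum.distrib scaleR_sum_right)

lemma bounded_linear_jac: "bounded_linear (jac f p)"
  using linear_conv_bounded_linear linear_jac by blast

text \<open>Both endpoints are free, as local injectivity near \<open>p\<close> requires. Going from
  \<open>q\<close> to \<open>r\<close> along one coordinate at a time, each leg changes
  \<open>f\<close> according to one partial derivative, which is close to its value at
  \<open>p\<close>.\<close>

lemma Ck_on_1_strict_derivative:
  fixes f :: "'a::euclidean_space \<Rightarrow> 'b::real_normed_vector"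
  assumes C1: "Ck_on 1 f S" and p: "p \<in> S" and e: "e > 0"
  obtains d where "d > 0" "ball p d \<subseteq> S"
    "\<And>q r. q \<in> ball p d \<Longrightarrow> r \<in> ball p d \<Longrightarrow> norm (f r - f q - jac f p (r - q)) \<le> e * norm (r - q)"
proof -
  \<comment> \<open>There is one leg per coordinate, each no longer than
    \<open>norm h\<close>.\<close>
  define e' where "e' = e / real DIM('a)"
  have DIM: "real DIM('a) > 0" by (simp add: DIM_positive)
  have e': "e' > 0" using e DIM by (simp add: e'_def)
  have "\<forall>v\<in>Basis. \<forall>\<^sub>F q in nhds p. dist (pdiff v f q) (pdiff v f p) < e'"
  proof
    fix v :: 'a assume "v \<in> Basis"
    then have "isCont (pdiff v f) p"
      using Ck_on_1D[OF C1] p by (metis continuous_on_eq_continuous_at)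
    then show "\<forall>\<^sub>F q in nhds p. dist (pdiff v f q) (pdiff v f p) < e'"
      using e' by (simp add: continuous_at tendsto_at_iff_tendsto_nhds tendstoD)
  qed
  then have "\<forall>\<^sub>F q in nhds p. \<forall>v\<in>Basis. dist (pdiff v f q) (pdiff v f p) < e'"
    by (rule eventually_ball_finite[OF finite_Basis])
  moreover have "\<forall>\<^sub>F q in nhds p. q \<in> S"
    using Ck_on_1D(1)[OF C1] p by (rule eventually_nhds_in_open)
  ultimately have "\<forall>\<^sub>F q in nhds p. q \<in> S \<and> (\<forall>v\<in>Basis. dist (pdiff v f q) (pdiff v f p) < e')"
    by eventually_elim simp
  then obtain D where D: "D > 0" and
    near: "\<And>q. dist q p < D \<Longrightarrow> q \<in> S \<and> (\<forall>v\<in>Basis. dist (pdiff v f q) (pdiff v f p) < e')"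
    unfolding eventually_nhds_metric by blast
  \<comment> \<open>Every point of the staircase from \<open>q\<close> then stays within
    \<open>D\<close> of \<open>p\<close>, where the partial derivatives are controlled.\<close>
  define d where "d = D / (1 + 2 * real DIM('a))"
  have d: "d > 0" "d + real DIM('a) * (2 * d) = D"
  proof -
    define N where "N = 1 + 2 * real DIM('a)"
    have "N > 0" using DIM by (simp add: N_def)
    moreover have "d = D / N" by (simp add: d_def N_def)
    ultimately have "d > 0" "d * N = D" using D by simp_all
    then show "d > 0" and "d + real DIM('a) * (2 * d) = D"
      by (simp_all add: N_def algebra_simps)
  qed
  have dD: "d \<le> D" using d DIM by (smt (verit) mult_nonneg_nonneg)
  show thesis
  proof
    show "d > 0" by fact
    show "ball p d \<subseteq> S" using near dD by (auto simp: dist_commute)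
    fix q r assume q: "q \<in> ball p d" and r: "r \<in> ball p d"
    define h where "h = r - q"
    have h: "norm h \<le> 2 * d"
      using q r norm_triangle_ineq4[of "r - p" "q - p"] by (simp add: h_def dist_norm norm_minus_commute)
    have loc: "dist (q + (\<Sum>v\<in>B. c v *\<^sub>R v)) p < D" if "B \<subseteq> Basis" "\<And>v. v \<in> B \<Longrightarrow> \<bar>c v\<bar> \<le> \<bar>h \<bullet> v\<bar>" for B c
    proof -
      have "norm (\<Sum>v\<in>B. c v *\<^sub>R v) \<le> (\<Sum>v\<in>B. norm h)"
      proof (rule sum_norm_le)
        fix v assume v: "v \<in> B"
        then have "norm v = 1" using that(1) by auto
        then show "norm (c v *\<^sub>R v) \<le> norm h"
          using that(2)[OF v] v that(1) Basis_le_norm[of v h] by auto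
      qed
      also have "\<dots> \<le> real DIM('a) * norm h"
        using that(1) by (simp add: card_mono mult_right_mono)
      also have "\<dots> \<le> real DIM('a) * (2 * d)" using h by (simp add: mult_left_mono)
      finally have "norm (\<Sum>v\<in>B. c v *\<^sub>R v) \<le> real DIM('a) * (2 * d)" .
      moreover have "norm (q - p) < d" using q by (simp add: dist_norm norm_minus_commute)
      ultimately show ?thesis
        using norm_triangle_ineq[of "q - p" "\<Sum>v\<in>B. c v *\<^sub>R v"] d(2)
        by (simp add: dist_norm algebra_simps)
    qed
    have main: "norm (f (q + (\<Sum>v\<in>B. (h \<bullet> v) *\<^sub>R v)) - f q - (\<Sum>v\<in>B. (h \<bullet> v) *\<^sub>R pdiff v f p)) \<le> e' * (\<Sum>v\<in>B. \<bar>h \<bullet> v\<bar>)"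
      if "finite B" "B \<subseteq> Basis" for B
      using that
    proof (induction B rule: finite_induct)
      case empty
      then show ?case by simp
    next
      case (insert v B)
      have v: "v \<in> Basis" and B: "B \<subseteq> Basis" using insert.prems by auto
      define Q where "Q = q + (\<Sum>v\<in>B. (h \<bullet> v) *\<^sub>R v)"
      define c where "c = h \<bullet> v"
      have seg: "dist (Q + t *\<^sub>R v) p < D" if "t \<in> closed_segment 0 c" for t
      proof -
        have "\<bar>t\<bar> \<le> \<bar>c\<bar>" using that by (auto simp: closed_segment_eq_real_ivl split: if_splits)
        then have "dist (q + (\<Sum>w\<in>insert v B. (if w = v then t else h \<bullet> w) *\<^sub>R w)) p < D"
          using insert.prems by (intro loc) (auto simp: c_def)
        moreover have "(\<Sum>w\<in>insert v B. (if w = v then t else h \<bullet> w) *\<^sub>R w) = t *\<^sub>R v + (\<Sum>w\<in>B. (h \<bullet> w) *\<^sub>R w)"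
          using insert.hyps by (simp, intro sum.cong) auto
        ultimately show ?thesis by (simp add: Q_def algebra_simps)
      qed
      \<comment> \<open>Subtracting the linear part leaves a small derivative along the leg, which
        suits the mean value inequality for vector-valued maps.\<close>
      have der: "((\<lambda>s. f (Q + s *\<^sub>R v) - s *\<^sub>R pdiff v f p) has_derivative
           (\<lambda>s. s *\<^sub>R (pdiff v f (Q + t *\<^sub>R v) - pdiff v f p))) (at t within closed_segment 0 c)"
        if "t \<in> closed_segment 0 c" for t
      proof -
        have "Q + t *\<^sub>R v \<in> S" using near seg[OF that] by blast
        from pdiff_along_line[OF Ck_on_1D(4)[OF C1 v this]]
        have "((\<lambda>s. f (Q + s *\<^sub>R v)) has_derivative (\<lambda>s. s *\<^sub>R pdiff v f (Q + t *\<^sub>R v))) (at t within closed_segment 0 c)"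
          by (simp add: has_vector_derivative_def)
        then show ?thesis
          by (auto intro!: derivative_eq_intros simp: algebra_simps)
      qed
      have "norm ((f (Q + c *\<^sub>R v) - c *\<^sub>R pdiff v f p) - (f (Q + 0 *\<^sub>R v) - 0 *\<^sub>R pdiff v f p)) \<le> e' * norm (c - 0)"
      proof (rule differentiable_bound[OF _ der])
        fix t assume "t \<in> closed_segment 0 c"
        then have "dist (pdiff v f (Q + t *\<^sub>R v)) (pdiff v f p) < e'" using near seg v by blast
        then show "onorm (\<lambda>s. s *\<^sub>R (pdiff v f (Q + t *\<^sub>R v) - pdiff v f p)) \<le> e'"
          using e' by (intro onorm_bound) (auto simp: dist_norm mult.commute[of e'] intro!: mult_left_mono)
      qed auto
      then have "norm (f (Q + c *\<^sub>R v) - f Q - c *\<^sub>R pdiff v f p) \<le> e' * \<bar>c\<bar>"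
        by (simp add: algebra_simps)
      moreover have "norm (f Q - f q - (\<Sum>v\<in>B. (h \<bullet> v) *\<^sub>R pdiff v f p)) \<le> e' * (\<Sum>v\<in>B. \<bar>h \<bullet> v\<bar>)"
        using insert.IH[OF B] by (simp add: Q_def)
      ultimately have "norm ((f (Q + c *\<^sub>R v) - f Q - c *\<^sub>R pdiff v f p) + (f Q - f q - (\<Sum>v\<in>B. (h \<bullet> v) *\<^sub>R pdiff v f p)))
         \<le> e' * \<bar>c\<bar> + e' * (\<Sum>v\<in>B. \<bar>h \<bullet> v\<bar>)"
        by (rule norm_triangle_mono)
      then show ?case
        using insert.hyps by (simp add: Q_def c_def algebra_simps)
    qed
    have "(\<Sum>v\<in>Basis. \<bar>h \<bullet> v\<bar>) \<le> (\<Sum>v\<in>(Basis::'a set). norm h)"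
      by (intro sum_mono) (auto simp: Basis_le_norm)
    then have "e' * (\<Sum>v\<in>Basis. \<bar>h \<bullet> v\<bar>) \<le> e' * (real DIM('a) * norm h)"
      using e' by (simp add: mult_left_mono)
    also have "\<dots> = e * norm h" using DIM by (simp add: e'_def)
    finally show "norm (f r - f q - jac f p (r - q)) \<le> e * norm (r - q)"
      using main[OF finite_Basis order_refl] by (simp add: euclidean_representation jac_def h_def)
  qed
qed

lemma Ck_on_1_has_derivative:
  assumes C1: "Ck_on 1 f S" and p: "p \<in> S"
  shows "(f has_derivative jac f p) (at p)"
  unfolding has_derivative_at_alt
proof (intro conjI allI impI)
  show "bounded_linear (jac f p)" by (rule bounded_linear_jac)
  fix e :: real assume "e > 0"
  then obtain d where "d > 0" 
    "\<And>q r. q \<in> ball p d \<Longrightarrow> r \<in> ball p d \<Longrightarrow> norm (f r - f q - jac f p (r - q)) \<le> e * norm (r - q)"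
    using Ck_on_1_strict_derivative[OF C1 p] by metis
  then show "\<exists>d>0. \<forall>y. norm (y - p) < d \<longrightarrow> norm (f y - f p - jac f p (y - p)) \<le> e * norm (y - p)"
    by (metis centre_in_ball dist_commute dist_norm mem_ball)
qed

lemma DF_eq_jac: "Ck_on 1 F S \<Longrightarrow> p \<in> S \<Longrightarrow> DF F p = jac F p"
  unfolding DF_def using frechet_derivative_at[OF Ck_on_1_has_derivative] by metis

subsection \<open>Interval matrices and lifted coordinates\<close>

lemma mnorm_mult_le: "mnorm A * norm v \<le> norm (A v)"
proof (cases "v = 0")
  case False
  let ?X = "{c. \<forall>v. c * norm v \<le> norm (A v)}"
  have "Sup ?X \<le> norm (A v) / norm v"
  proof (rule cSup_least)
    have "0 \<in> ?X" by simp
    then show "?X \<noteq> {}" by blast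
  qed (use False in \<open>auto simp: field_simps\<close>)
  then show ?thesis using False by (simp add: mnorm_def field_simps)
qed simp

lemma mnorm_nonneg:
  fixes A :: "'a::euclidean_space \<Rightarrow> 'b::real_normed_vector"
  shows "0 \<le> mnorm A"
  unfolding mnorm_def
proof (rule cSup_upper)
  obtain v :: 'a where v: "v \<in> Basis" using nonempty_Basis by blast
  show "bdd_above {c. \<forall>v. c * norm v \<le> norm (A v)}"
    by (rule bdd_aboveI[of _ "norm (A v)"]) (use v in \<open>auto dest: spec[of _ v]\<close>)
qed simp

lemma m_set_le:
  fixes S :: "('a::euclidean_space \<Rightarrow> 'b::real_normed_vector) set"
  assumes "A \<in> S"
  shows "m_set S * norm v \<le> norm (A v)"
proof -
  have "m_set S \<le> mnorm A"
    unfolding m_set_def using assms by (intro cInf_lower bdd_belowI[of _ 0]) (auto simp: mnorm_nonneg)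
  then show ?thesis
    using mnorm_mult_le[of A v] by (meson mult_right_mono norm_ge_zero order_trans)
qed

lemma m_set_nonneg:
  fixes S :: "('a::euclidean_space \<Rightarrow> 'b::real_normed_vector) set"
  assumes "S \<noteq> {}"
  shows "0 \<le> m_set S"
  unfolding m_set_def using assms by (intro cInf_greatest) (auto simp: mnorm_nonneg)

text \<open>The bound \<open>C\<close> keeps the Inf and Sup of the entries from being unspecified
  values. Different entries of \<open>A\<close> may come from different points of
  \<open>U\<close>.\<close>

lemma ivmat_memI:
  fixes A :: "'a::euclidean_space \<Rightarrow> 'b::euclidean_space"
  assumes "linear A" and ex: "\<And>i j. i \<in> Basis \<Longrightarrow> j \<in> Basis \<Longrightarrow> \<exists>p\<in>U. A j \<bullet> i = G p j \<bullet> i"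
    and bdd: "\<And>p j. p \<in> U \<Longrightarrow> j \<in> Basis \<Longrightarrow> norm (G p j) \<le> C"
  shows "A \<in> ivmat G U"
  unfolding ivmat_def mem_Collect_eq
proof (intro conjI ballI)
  fix i :: 'b and j :: 'a assume ij: "i \<in> Basis" "j \<in> Basis"
  have bnd: "-C \<le> G p j \<bullet> i \<and> G p j \<bullet> i \<le> C" if "p \<in> U" for p
    using bdd[OF that ij(2)] Basis_le_norm[OF ij(1), of "G p j"] by linarith
  have mem: "A j \<bullet> i \<in> {G p j \<bullet> i | p. p \<in> U}" using ex[OF ij] by blast
  show "Inf {G p j \<bullet> i | p. p \<in> U} \<le> A j \<bullet> i"
    by (rule cInf_lower[OF mem bdd_belowI[of _ "-C"]]) (use bnd in blast)
  show "A j \<bullet> i \<le> Sup {G p j \<bullet> i | p. p \<in> U}"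
    by (rule cSup_upper[OF mem bdd_aboveI[of _ C]]) (use bnd in blast)
qed fact

text \<open>The mean value theorem holds only componentwise, with an intermediate point for each row;
  interval matrices absorb this.\<close>
lemma ivmat_mean_value:
  fixes f :: "'a::euclidean_space \<Rightarrow> 'b::euclidean_space"
  assumes der: "\<And>q. q \<in> closed_segment a b \<Longrightarrow> (f has_derivative G (\<phi> q)) (at q)"
    and U: "\<And>q. q \<in> closed_segment a b \<Longrightarrow> \<phi> q \<in> U"
    and bdd: "\<And>p j. p \<in> U \<Longrightarrow> j \<in> Basis \<Longrightarrow> norm (G p j) \<le> C"
  obtains A where "A \<in> ivmat G U" "f b - f a = A (b - a)"
proof -
  have "\<exists>q\<in>closed_segment a b. (f b - f a) \<bullet> i = G (\<phi> q) (b - a) \<bullet> i" for i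
  proof -
    have seg: "a + t *\<^sub>R (b - a) \<in> closed_segment a b" if "t \<in> {0..1}" for t
      using that by (auto simp: in_segment algebra_simps intro!: exI[of _ t])
    have "((\<lambda>t. f (a + t *\<^sub>R (b - a)) \<bullet> i) has_derivative (\<lambda>s. G (\<phi> (a + t *\<^sub>R (b - a))) (s *\<^sub>R (b - a)) \<bullet> i)) (at t within {0..1})"
      if "t \<in> {0..1}" for t
    proof -
      have "((\<lambda>t. a + t *\<^sub>R (b - a)) has_derivative (\<lambda>s. s *\<^sub>R (b - a))) (at t within {0..1})"
        by (auto intro!: derivative_eq_intros)
      from has_derivative_compose[OF this der[OF seg[OF that]]]
      show ?thesis by (rule has_derivative_inner_left)
    qed
    then obtain t where "t \<in> {0<..<1}"
      "f (a + 1 *\<^sub>R (b - a)) \<bullet> i - f (a + 0 *\<^sub>R (b - a)) \<bullet> i = G (\<phi> (a + t *\<^sub>R (b - a))) ((1 - 0) *\<^sub>R (b - a)) \<bullet> i"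
      using mvt_simple[of 0 1 "\<lambda>t. f (a + t *\<^sub>R (b - a)) \<bullet> i"
          "\<lambda>t s. G (\<phi> (a + t *\<^sub>R (b - a))) (s *\<^sub>R (b - a)) \<bullet> i"] by auto
    then show ?thesis using seg[of t] by (intro bexI[of _ "a + t *\<^sub>R (b - a)"]) (auto simp: inner_diff_left)
  qed
  then obtain q where q: "\<And>i. q i \<in> closed_segment a b" "\<And>i. (f b - f a) \<bullet> i = G (\<phi> (q i)) (b - a) \<bullet> i"
    by metis
  define A where "A v = (\<Sum>i\<in>Basis. (G (\<phi> (q i)) v \<bullet> i) *\<^sub>R i)" for v
  have lin: "linear (G (\<phi> (q i)))" for i
    using der[OF q(1)] has_derivative_linear by blast
  have Ai: "A v \<bullet> i = G (\<phi> (q i)) v \<bullet> i" if "i \<in> Basis" for v i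
    using that by (simp add: A_def)
  show thesis
  proof
    have "linear A"
      unfolding A_def by (rule linearI)
        (simp_all add: linear_add[OF lin] linear_scale[OF lin] inner_add_left scaleR_add_left sum.distrib scaleR_sum_right)
    then show "A \<in> ivmat G U"
      by (rule ivmat_memI) (use Ai U[OF q(1)] bdd in blast)+
    show "f b - f a = A (b - a)"
      by (rule euclidean_eqI) (simp add: q(2) Ai)
  qed
qed

section \<open>Integer translations, projections and congruent lifts\<close>

lemma intvec_small: "intvec n \<Longrightarrow> norm n < 1 \<Longrightarrow> n = 0"
  unfolding intvec_def vec_eq_iff
  by (metis Ints_nonzero_abs_less1 component_le_norm_cart order_le_less_trans zero_index)

lemma intvec_0 [simp]: "intvec 0"
  and intvec_add: "intvec a \<Longrightarrow> intvec b \<Longrightarrow> intvec (a + b)"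
  and intvec_diff: "intvec a \<Longrightarrow> intvec b \<Longrightarrow> intvec (a - b)"
  and intvec_minus: "intvec a \<Longrightarrow> intvec (- a)"
  by (auto simp: intvec_def)

definition pt_of :: "(real^'c::finite) \<times> (real^'u::finite) \<Rightarrow> real^'s::finite \<Rightarrow> ('c,'u,'s) pt"
  where "pt_of a y = (fst a, snd a, y)"

lemma pt_of_simps [simp]: "lx (pt_of a y) = a" "yc (pt_of a y) = y" "lam (pt_of a y) = fst a" "xc (pt_of a y) = snd a"
  "pt_of (lx p) (yc p) = p" "fst (lx p) = lam p" "snd (lx p) = xc p"
  by (auto simp: pt_of_def lx_def yc_def lam_def xc_def)

lemma pt_eqI: "lx p = lx q \<Longrightarrow> yc p = yc q \<Longrightarrow> p = q"
  by (metis pt_of_simps(5))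

lemma proj_diff [simp]:
  "lam (p - q) = lam p - lam q" "xc (p - q) = xc p - xc q" "yc (p - q) = yc p - yc q" "lx (p - q) = lx p - lx q"
  by (auto simp: lx_def yc_def lam_def xc_def)

lemma proj_shiftl [simp]:
  "lam (shiftl n p) = lam p + n" "xc (shiftl n p) = xc p" "yc (shiftl n p) = yc p"
  by (auto simp: shiftl_def lx_def yc_def lam_def xc_def)

lemma bounded_linear_proj:
  "bounded_linear lam" "bounded_linear xc" "bounded_linear yc" "bounded_linear lx"
  unfolding lam_def[abs_def] xc_def[abs_def] yc_def[abs_def] lx_def[abs_def]
  by (auto intro!: bounded_linear_intros bounded_linear_Pair)

lemma bounded_linear_in: "bounded_linear in_y" "bounded_linear in_lx"
  unfolding in_y_def[abs_def] in_lx_def[abs_def] by (auto intro!: bounded_linear_intros bounded_linear_Pair)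

lemma norm_pt: "norm p = sqrt ((norm (lx p))\<^sup>2 + (norm (yc p))\<^sup>2)"
  by (cases p) (simp add: norm_Pair lx_def yc_def)

lemma norm_lx: "norm (lx p) = sqrt ((norm (lam p))\<^sup>2 + (norm (xc p))\<^sup>2)"
  by (cases p) (simp add: norm_Pair lx_def lam_def xc_def)

lemma norm_proj_le: "norm (lx p) \<le> norm p" "norm (yc p) \<le> norm p" "norm (lam p) \<le> norm (lx p)" "norm (xc p) \<le> norm (lx p)"
  by (auto simp: norm_pt norm_lx intro!: real_le_rsqrt)

lemma norm_in [simp]: "norm (in_y v) = norm v" "norm (in_lx w) = norm w"
  by (auto simp: norm_pt in_y_def in_lx_def lx_def yc_def)

lemma in_decomp: "in_lx (lx p) + in_y (yc p) = p"
  by (auto simp: in_y_def in_lx_def lx_def yc_def)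

lemma norm_le_lx_yc: "norm p \<le> norm (lx p) + norm (yc p)"
  using norm_triangle_ineq[of "in_lx (lx p)" "in_y (yc p)"] by (simp add: in_decomp)

lemma mem_Dl: "p \<in> Dl R \<longleftrightarrow> norm (xc p) \<le> R \<and> norm (yc p) \<le> R"
  by (auto simp: Dl_def xc_def yc_def mem_Times_iff)

lemma shiftl_Dl [simp]: "shiftl n p \<in> Dl R \<longleftrightarrow> p \<in> Dl R"
  by (simp add: mem_Dl)

lemma closed_Dl: "closed (Dl R)" and convex_Dl: "convex (Dl R)"
  by (auto simp: Dl_def closed_Times convex_Times)

lemma teq_iff: "teq p q \<longleftrightarrow> (\<exists>n. intvec n \<and> p = shiftl n q)"
proof
  assume "teq p q"
  then show "\<exists>n. intvec n \<and> p = shiftl n q"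
    by (intro exI[of _ "lam p - lam q"]) (auto simp: teq_def shiftl_def lam_def xc_def yc_def prod_eq_iff)
qed (auto simp: teq_def)

lemma teq_refl [simp]: "teq p p" and teq_sym: "teq p q \<Longrightarrow> teq q p"
  and teq_trans: "teq p q \<Longrightarrow> teq q r \<Longrightarrow> teq p r"
proof -
  show "teq p p" by (simp add: teq_def)
  show "teq q p" if "teq p q" using that intvec_minus[of "lam p - lam q"] by (simp add: teq_def)
  show "teq p r" if "teq p q" "teq q r"
    using that intvec_add[of "lam p - lam q" "lam q - lam r"] by (simp add: teq_def)
qed

lemma teq_Dl: "teq p q \<Longrightarrow> p \<in> Dl R \<longleftrightarrow> q \<in> Dl R"
  by (auto simp: teq_def mem_Dl)

text \<open>This is how equality modulo integers becomes equality: by continuity in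
  \<open>pdiff_shiftl\<close>, by contraction in \<open>Ws_unique\<close>.\<close>

lemma teq_close: "teq p q \<Longrightarrow> norm (lam p - lam q) < 1 \<Longrightarrow> p = q"
  using intvec_small[of "lam p - lam q"] by (auto simp: teq_def lam_def xc_def yc_def prod_eq_iff)

lemma Js_iff: "w \<in> Js z M \<longleftrightarrow> (\<exists>q. teq q w \<and> q \<in> Js_chart z M)"
  unfolding Js_def teq_iff by blast

lemma Js_teq: "teq p q \<Longrightarrow> p \<in> Js z M \<longleftrightarrow> q \<in> Js z M"
  unfolding Js_iff by (meson teq_sym teq_trans)

subsection \<open>Estimates for a lifted torus map\<close>

locale torus_map =
  fixes F :: "(real^'c::finite) \<times> (real^'u::finite) \<times> (real^'s::finite)
              \<Rightarrow> (real^'c) \<times> (real^'u) \<times> (real^'s)"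
    and R :: real and S
  assumes R_pos: "0 < R" and lift: "is_lift_map R F" and D_S: "Dl R \<subseteq> S" and C1: "Ck_on 1 F S"
begin

lemma F_teq:
  assumes "p \<in> Dl R" "teq p q"
  shows "teq (F p) (F q)"
proof -
  obtain n where "intvec n" "q = shiftl n p"
    using teq_sym[OF assms(2)] unfolding teq_iff by blast
  then show ?thesis
    using lift assms(1) by (auto simp: is_lift_map_def intro: teq_sym)
qed

lemma funpow_teq:
  assumes "\<And>n. (F ^^ n) p \<in> Dl R" "teq p q"
  shows "teq ((F ^^ n) p) ((F ^^ n) q)"
  by (induction n) (auto simp: assms F_teq)

lemma F_has_derivative: "p \<in> Dl R \<Longrightarrow> (F has_derivative DF F p) (at p)"
  using Ck_on_1_has_derivative[OF C1] DF_eq_jac[OF C1] D_S by (metis subsetD)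

lemma isCont_F: "p \<in> Dl R \<Longrightarrow> isCont F p"
  using F_has_derivative has_derivative_continuous by blast

text \<open>The integer vector by which \<open>F\<close> changes under translation may depend on the
  point, but it is continuous along the line through \<open>p\<close>, hence locally constant, and
  has derivative 0. At an interior point the line stays in \<open>Dl R\<close>, where the lift
  relation is known.\<close>

lemma pdiff_shiftl:
  assumes p: "p \<in> interior (Dl R)" and n: "intvec n" and v: "v \<in> Basis"
  shows "pdiff v F (shiftl n p) = pdiff v F p"
proof -
  define g where "g t = F (shiftl n p + t *\<^sub>R v) - F (p + t *\<^sub>R v)" for t
  have pD: "p \<in> Dl R" using p interior_subset by blast
  have "((\<lambda>t. p + t *\<^sub>R v) \<longlongrightarrow> p + 0 *\<^sub>R v) (at 0)"
    by (intro tendsto_intros)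
  then have ev1: "\<forall>\<^sub>F t in at 0. p + t *\<^sub>R v \<in> interior (Dl R)"
    using p by (auto dest: topological_tendstoD[OF _ open_interior])
  have der: "((\<lambda>s. F (q + s *\<^sub>R v)) has_vector_derivative pdiff v F q) (at 0)" if "q \<in> Dl R" for q
    using pdiff_along_line[of F q 0 v] Ck_on_1D(4)[OF C1 v, of q] that D_S by auto
  have g': "(g has_vector_derivative (pdiff v F (shiftl n p) - pdiff v F p)) (at 0)"
    unfolding g_def[abs_def] using pD by (intro has_vector_derivative_diff der) auto
  then have "(g \<longlongrightarrow> g 0) (at 0)"
    using has_vector_derivative_continuous isCont_def by blast
  then have ev2: "\<forall>\<^sub>F t in at 0. dist (g t) (g 0) < 1"
    by (rule tendstoD) simp
  have "\<forall>\<^sub>F t in at 0. g t = g 0"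
    using ev1 ev2
  proof eventually_elim
    case (elim t)
    have gt: "intvec (lam (g t)) \<and> xc (g t) = 0 \<and> yc (g t) = 0" if "p + t *\<^sub>R v \<in> Dl R" for t
    proof -
      have "shiftl n p + t *\<^sub>R v = shiftl n (p + t *\<^sub>R v)"
        by (simp add: shiftl_def prod_eq_iff)
      then have "teq (F (shiftl n p + t *\<^sub>R v)) (F (p + t *\<^sub>R v))"
        using lift n that by (simp add: is_lift_map_def)
      then show ?thesis by (simp add: g_def teq_def)
    qed
    have "norm (g t - g 0) < 1" using elim(2) by (simp add: dist_norm)
    then have "norm (lam (g t) - lam (g 0)) < 1"
      using norm_proj_le(1,3)[of "g t - g 0"] by simp
    moreover have "p + t *\<^sub>R v \<in> Dl R" using elim(1) interior_subset by blast
    ultimately have "teq (g t) (g 0)" "norm (lam (g t) - lam (g 0)) < 1"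
      using gt[of t] gt[of 0] pD by (auto simp: teq_def intvec_diff)
    then show ?case by (rule teq_close)
  qed
  then have "(g has_vector_derivative 0) (at 0)"
    by (subst has_vector_derivative_cong_ev[where g="\<lambda>_. g 0"])
      (auto simp: eventually_at_filter elim: eventually_mono)
  from vector_derivative_unique_at[OF g' this] show ?thesis by simp
qed

lemma closure_interior_Dl: "closure (interior (Dl R)) = Dl R"
  using R_pos by (auto simp: Dl_def interior_Times closure_Times)

text \<open>\<open>Dl R\<close> is not compact in \<lambda>. Periodicity moves interior points into
  the compact set \<open>K\<close>, and continuity carries the bound to the boundary of
  \<open>Dl R\<close>.\<close>

lemma pdiff_bounded:
  assumes v: "v \<in> Basis"
  shows "\<exists>C. \<forall>p\<in>Dl R. norm (pdiff v F p) \<le> C"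
proof -
  define K where "K = (cbox 0 1 :: (real^'c) set) \<times> (cball 0 R :: (real^'u) set) \<times> (cball 0 R :: (real^'s) set)"
  have KD: "K \<subseteq> Dl R" by (auto simp: K_def Dl_def)
  have cont: "continuous_on (Dl R) (pdiff v F)"
    using Ck_on_1D(3)[OF C1 v] D_S continuous_on_subset by blast
  have "compact K" by (simp add: K_def compact_Times)
  then have "bounded (pdiff v F ` K)"
    using cont KD by (intro compact_imp_bounded compact_continuous_image continuous_on_subset[OF cont])
  then obtain C where C: "\<And>p. p \<in> K \<Longrightarrow> norm (pdiff v F p) \<le> C"
    by (auto simp: bounded_iff)
  have int: "norm (pdiff v F p) \<le> C" if p: "p \<in> interior (Dl R)" for p
  proof -
    define n :: "real^'c" where "n = (\<chi> i. - of_int \<lfloor>lam p $ i\<rfloor>)"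
    have n: "intvec n" by (simp add: n_def intvec_def)
    have "p \<in> Dl R" using p interior_subset by blast
    then have "shiftl n p \<in> K"
      by (auto simp: K_def shiftl_def mem_Times_iff mem_box_cart n_def lam_def Dl_def)
        (smt (verit) real_of_int_floor_add_one_ge)
    then show ?thesis using C pdiff_shiftl[OF p n v] by metis
  qed
  have "norm (pdiff v F p) \<le> C" if "p \<in> Dl R" for p
    using continuous_on_closure_norm_le[of "interior (Dl R)" "pdiff v F" C p] cont int that
    by (simp add: closure_interior_Dl)
  then show ?thesis by blast
qed

lemma DF_bounded: "\<exists>C. \<forall>p\<in>Dl R. \<forall>h. norm (DF F p h) \<le> C * norm h"
proof -
  obtain C where C: "\<And>v p. v \<in> Basis \<Longrightarrow> p \<in> Dl R \<Longrightarrow> norm (pdiff v F p) \<le> C v"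
    using pdiff_bounded by metis
  have "norm (DF F p h) \<le> (\<Sum>v\<in>Basis. C v) * norm h" if p: "p \<in> Dl R" for p h
  proof -
    have "DF F p h = jac F p h" using DF_eq_jac[OF C1] p D_S by (metis subsetD)
    also have "norm \<dots> \<le> (\<Sum>v\<in>Basis. C v * norm h)"
      unfolding jac_def
    proof (rule sum_norm_le)
      fix v :: "(real^'c) \<times> (real^'u) \<times> (real^'s)" assume v: "v \<in> Basis"
      show "norm ((h \<bullet> v) *\<^sub>R pdiff v F p) \<le> C v * norm h"
        using mult_mono[OF Basis_le_norm[OF v, of h] C[OF v p]] by (simp add: mult.commute)
    qed
    finally show ?thesis by (simp add: sum_distrib_right)
  qed
  then show ?thesis by blast
qed

text \<open>A uniform derivative bound on the unbounded set \<open>Dl R\<close>. It makes the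
  suprema of operator norms below genuine and is a Lipschitz constant of the lift.\<close>

definition CF :: real where
  "CF = (SOME C. \<forall>p\<in>Dl R. \<forall>h. norm (DF F p h) \<le> C * norm h)"

lemma DF_le: "p \<in> Dl R \<Longrightarrow> norm (DF F p h) \<le> CF * norm h"
  unfolding CF_def using someI_ex[OF DF_bounded] by blast

lemma zero_in_Dl: "0 \<in> Dl R"
  using R_pos by (simp add: mem_Dl xc_def yc_def)

lemma CF_nonneg: "CF \<ge> 0"
proof -
  obtain h :: "(real^'c) \<times> (real^'u) \<times> (real^'s)" where "norm h = 1"
    using nonempty_Basis norm_Basis by blast
  then have "norm (DF F 0 h) \<le> CF" using DF_le[OF zero_in_Dl, of h] by simp
  then show ?thesis using norm_ge_zero order_trans by blast
qed

lemma F_lipschitz: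
  assumes "p \<in> Dl R" "q \<in> Dl R"
  shows "norm (F p - F q) \<le> CF * norm (p - q)"
proof (rule differentiable_bound[OF convex_Dl _ _ assms])
  fix x :: "('c, 'u, 's) pt" assume x: "x \<in> Dl R"
  show "(F has_derivative DF F x) (at x within Dl R)"
    using F_has_derivative[OF x] by (rule has_derivative_at_withinI)
  show "onorm (DF F x) \<le> CF" using DF_le[OF x] CF_nonneg by (intro onorm_bound) auto
qed

lemma bounded_linear_DF: "p \<in> Dl R \<Longrightarrow> bounded_linear (DF F p)"
  using F_has_derivative has_derivative_bounded_linear by blast

lemma bounded_linear_partial:
  assumes "p \<in> Dl R"
  shows "bounded_linear (dyfy F p)" "bounded_linear (dlxfy F p)" "bounded_linear (dyflx F p)" "bounded_linear (dlxflx F p)"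
  unfolding dyfy_def dlxfy_def dyflx_def dlxflx_def comp_def
  by (rule bounded_linear_compose[OF _ bounded_linear_compose[OF bounded_linear_DF[OF assms]]];
      rule bounded_linear_proj bounded_linear_in)+

lemma partial_le:
  assumes "p \<in> Dl R"
  shows "norm (dyfy F p v) \<le> CF * norm v" "norm (dlxfy F p w) \<le> CF * norm w"
    "norm (dyflx F p v) \<le> CF * norm v" "norm (dlxflx F p w) \<le> CF * norm w"
  unfolding dyfy_def dlxfy_def dyflx_def dlxflx_def
  using norm_proj_le(1,2) DF_le[OF assms, of "in_y v"] DF_le[OF assms, of "in_lx w"]
  by (metis comp_apply norm_in order_trans)+

lemma onorm_partial_le:
  assumes "p \<in> Dl R"
  shows "onorm (dyfy F p) \<le> CF" "onorm (dlxfy F p) \<le> CF" "onorm (dyflx F p) \<le> CF" "onorm (dlxflx F p) \<le> CF"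
  using partial_le[OF assms] CF_nonneg by (auto intro!: onorm_bound)

lemma DF_split:
  assumes "p \<in> Dl R"
  shows "yc (DF F p h) = dlxfy F p (lx h) + dyfy F p (yc h)"
    "lx (DF F p h) = dlxflx F p (lx h) + dyflx F p (yc h)"
proof -
  have "DF F p h = DF F p (in_lx (lx h)) + DF F p (in_y (yc h))"
    by (metis in_decomp bounded_linear.linear[OF bounded_linear_DF[OF assms]] linear_add)
  then show "yc (DF F p h) = dlxfy F p (lx h) + dyfy F p (yc h)"
    "lx (DF F p h) = dlxflx F p (lx h) + dyflx F p (yc h)"
    by (auto simp: dlxfy_def dyfy_def dlxflx_def dyflx_def yc_def lx_def)
qed

section \<open>Rates as suprema and infima, and finite-difference estimates\<close>

lemma supD_upper:
  assumes "p \<in> Dl R" "\<And>q. q \<in> Dl R \<Longrightarrow> g q \<le> C"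
  shows "g p \<le> supD R g"
  unfolding supD_def using assms by (intro cSUP_upper bdd_aboveI[of _ C]) auto

lemma infD_lower:
  assumes "p \<in> Dl R" "\<And>q. q \<in> Dl R \<Longrightarrow> C \<le> g q"
  shows "infD R g \<le> g p"
  unfolding infD_def using assms by (intro cINF_lower bdd_belowI[of _ C]) auto

text \<open>\<open>\<mu> M\<close> is the \<mu> of the theorem and \<open>\<mu> (1 / L)\<close> is
  \<open>mu_s1\<close>, so that one estimate serves both cones.\<close>

definition \<mu> :: "real \<Rightarrow> real" where
  "\<mu> \<kappa> = supD R (\<lambda>p. onorm (dyfy F p) + \<kappa> * onorm (dlxfy F p))"

lemma mu_upper:
  assumes "\<kappa> \<ge> 0" "p \<in> Dl R"
  shows "onorm (dyfy F p) + \<kappa> * onorm (dlxfy F p) \<le> \<mu> \<kappa>"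
  unfolding \<mu>_def
  by (rule supD_upper[OF assms(2), where C="CF + \<kappa> * CF"])
    (intro add_mono mult_left_mono onorm_partial_le assms(1))

lemma mu_nonneg: "\<kappa> \<ge> 0 \<Longrightarrow> \<mu> \<kappa> \<ge> 0"
  by (rule order_trans[OF _ mu_upper[OF _ zero_in_Dl]])
    (auto intro!: add_nonneg_nonneg mult_nonneg_nonneg onorm_pos_le bounded_linear_partial zero_in_Dl)

text \<open>The two bounds share a free scale \<open>s\<close>: inside a cone it is the distance in
  y, outside it the distance in (\<lambda>, x) divided by the slope. The segment between the lifts
  stays in the convex set \<open>Dl R\<close>.\<close>

lemma yc_estimate:
  assumes w: "w1 \<in> Dl R" "w2 \<in> Dl R" and k: "\<kappa> \<ge> 0"
    and y: "norm (yc w1 - yc w2) \<le> s" and x: "norm (lx w1 - lx w2) \<le> \<kappa> * s"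
  shows "norm (yc (F w1) - yc (F w2)) \<le> \<mu> \<kappa> * s"
proof -
  define h where "h = w1 - w2"
  have s: "s \<ge> 0" using y norm_ge_zero order_trans by blast
  have seg: "w2 + t *\<^sub>R h \<in> Dl R" if "t \<in> {0..1}" for t
    using convexD_alt[OF convex_Dl w(2,1), of t] that by (simp add: h_def algebra_simps)
  define \<phi> where "\<phi> t = yc (F (w2 + t *\<^sub>R h))" for t
  have "norm (\<phi> 1 - \<phi> 0) \<le> (\<mu> \<kappa> * s) * norm (1 - 0 :: real)"
  proof (rule differentiable_bound)
    fix t :: real assume t: "t \<in> {0..1}"
    have "((\<lambda>t. w2 + t *\<^sub>R h) has_derivative (\<lambda>r. r *\<^sub>R h)) (at t within {0..1})"
      by (auto intro!: derivative_eq_intros)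
    from has_derivative_compose[OF this F_has_derivative[OF seg[OF t]]]
    show "(\<phi> has_derivative (\<lambda>r. yc (DF F (w2 + t *\<^sub>R h) (r *\<^sub>R h)))) (at t within {0..1})"
      unfolding \<phi>_def[abs_def] by (rule bounded_linear.has_derivative[OF bounded_linear_proj(3)])
    define p where "p = w2 + t *\<^sub>R h"
    have p: "p \<in> Dl R" using seg t by (simp add: p_def)
    have "norm (yc (DF F p h)) \<le> onorm (dlxfy F p) * norm (lx h) + onorm (dyfy F p) * norm (yc h)"
      unfolding DF_split[OF p]
      by (intro norm_triangle_mono onorm bounded_linear_partial p)
    also have "\<dots> \<le> onorm (dlxfy F p) * (\<kappa> * s) + onorm (dyfy F p) * s"
      using x y by (intro add_mono mult_left_mono onorm_pos_le bounded_linear_partial p) (auto simp: h_def)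
    also have "\<dots> = (onorm (dyfy F p) + \<kappa> * onorm (dlxfy F p)) * s" by (simp add: algebra_simps)
    also have "\<dots> \<le> \<mu> \<kappa> * s" using s k p by (intro mult_right_mono mu_upper)
    finally have *: "norm (yc (DF F p h)) \<le> \<mu> \<kappa> * s" .
    have "yc (DF F p (r *\<^sub>R h)) = r *\<^sub>R yc (DF F p h)" for r
      using bounded_linear.linear[OF bounded_linear_DF[OF p]] bounded_linear.linear[OF bounded_linear_proj(3)]
      by (metis linear_scale)
    then show "onorm (\<lambda>r. yc (DF F (w2 + t *\<^sub>R h) (r *\<^sub>R h))) \<le> \<mu> \<kappa> * s"
      using * s mu_nonneg[OF k] unfolding p_def[symmetric]
      by (intro onorm_bound) (auto simp: mult.commute[of _ "\<bar>_\<bar>"] intro!: mult_left_mono)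
  qed auto
  then show ?thesis by (simp add: \<phi>_def h_def)
qed

text \<open>Expansion in (\<lambda>, x) and influence of y, kept apart because the weights vary:
  subtracting \<open>1 / M * sup_dyflx\<close> gives \<xi>, subtracting \<open>L * sup_dyflx\<close>
  gives \<open>xi_cu1P\<close>.\<close>

definition "inf_m_dlxflx = infD R (\<lambda>z. m_set (ivmat (dlxflx F) (Pset R z)))"
definition "sup_dyflx = supD R (\<lambda>p. onorm (dyflx F p))"

lemma tdistc_le: "tdistc a b \<le> norm (a - b)"
  unfolding tdistc_def
  by (rule cInf_lower[OF _ bdd_belowI[of _ 0]]) (auto intro!: exI[of _ 0])

lemma Pset_subset: "Pset R z \<subseteq> Dl R"
  by (auto simp: Pset_def)

lemma ivmat_nonempty:
  assumes z: "z \<in> Dl R"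
  shows "ivmat (dlxflx F) (Pset R z) \<noteq> {}"
proof -
  have 1: "z \<in> Pset R z" using z tdistc_le[of "lam z" "lam z"] by (simp add: Pset_def RLam_def)
  have 2: "norm (dlxflx F p j) \<le> CF" if "p \<in> Pset R z" "j \<in> Basis" for p j
    using partial_le(4)[of p j] Pset_subset[THEN subsetD, of p z] that by simp
  have "dlxflx F z \<in> ivmat (dlxflx F) (Pset R z)"
    by (rule ivmat_memI[OF bounded_linear.linear[OF bounded_linear_partial(4)[OF z]] _ 2]) (use 1 in blast)
  then show ?thesis by blast
qed

lemma inf_m_dlxflx_lower: "z \<in> Dl R \<Longrightarrow> inf_m_dlxflx \<le> m_set (ivmat (dlxflx F) (Pset R z))"
  unfolding inf_m_dlxflx_def by (rule infD_lower[where C=0]) (simp_all add: m_set_nonneg ivmat_nonempty)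

lemma sup_dyflx_upper: "p \<in> Dl R \<Longrightarrow> onorm (dyflx F p) \<le> sup_dyflx"
  unfolding sup_dyflx_def by (rule supD_upper) (auto intro: onorm_partial_le)

lemma sup_dyflx_nonneg: "sup_dyflx \<ge> 0"
  using sup_dyflx_upper[OF zero_in_Dl] onorm_pos_le[OF bounded_linear_partial(3)[OF zero_in_Dl]] by linarith

text \<open>Passing from \<open>w2\<close> to \<open>w1\<close> first in y and then in (\<lambda>,
  x) separates a loss, bounded by the y-derivative, from a gain, given by an interval
  matrix.\<close>

lemma lx_estimate:
  assumes w: "w1 \<in> Dl R" "w2 \<in> Dl R" and l: "norm (lam w1 - lam w2) \<le> RLam"
  shows "inf_m_dlxflx * norm (lx w1 - lx w2) - sup_dyflx * norm (yc w1 - yc w2) \<le> norm (lx (F w1) - lx (F w2))"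
proof -
  define a b where "a = lx w2" and "b = lx w1"
  \<comment> \<open>The midpoint is the right centre: a segment of \<lambda>-length at most
    \<open>RLam\<close> lies within \<open>RLam / 2\<close> of it, hence in
    \<open>Pset R z\<close>.\<close>
  define z where "z = pt_of ((1/2) *\<^sub>R (a + b)) (yc w1)"
  have segx: "norm (snd q) \<le> R \<and> norm (fst q - lam z) \<le> RLam / 2" if q: "q \<in> closed_segment a b" for q
  proof -
    obtain t where t: "0 \<le> t" "t \<le> 1" "q = (1 - t) *\<^sub>R a + t *\<^sub>R b" using q by (auto simp: in_segment)
    have "norm (snd q) \<le> R"
      using convexD_alt[OF convex_cball[of 0 R], of "xc w2" "xc w1" t] w t by (simp add: mem_Dl a_def b_def)
    moreover have "fst q - lam z = (t - 1/2) *\<^sub>R (lam w1 - lam w2)"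
      by (simp add: t z_def a_def b_def vec_eq_iff field_simps)
    moreover have "norm ((t - 1/2) *\<^sub>R (lam w1 - lam w2)) \<le> (1/2) * RLam"
      unfolding norm_scaleR using t l by (intro mult_mono) (auto simp: abs_if)
    ultimately show ?thesis by simp
  qed
  have z: "z \<in> Dl R"
    using segx[OF midpoint_in_closed_segment] w by (simp add: z_def mem_Dl midpoint_def)
  have pt_of_der: "((\<lambda>q. pt_of q (yc w1)) has_derivative in_lx) (at q)" for q
    unfolding pt_of_def in_lx_def[abs_def] by (auto intro!: derivative_eq_intros)
  have der: "((\<lambda>q. lx (F (pt_of q (yc w1)))) has_derivative dlxflx F (pt_of q (yc w1))) (at q)"
    if "pt_of q (yc w1) \<in> Dl R" for q
    unfolding dlxflx_def comp_def
    by (rule bounded_linear.has_derivative[OF bounded_linear_proj(4)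
          has_derivative_compose[where f="\<lambda>q. pt_of q (yc w1)" and g=F, OF pt_of_der F_has_derivative[OF that]]])
  have P: "pt_of q (yc w1) \<in> Pset R z" if "q \<in> closed_segment a b" for q
    using segx[OF that] tdistc_le[of "fst q" "lam z"] w by (auto simp: Pset_def mem_Dl)
  obtain A where A: "A \<in> ivmat (dlxflx F) (Pset R z)" 
    "lx (F (pt_of b (yc w1))) - lx (F (pt_of a (yc w1))) = A (b - a)"
  proof (rule ivmat_mean_value[of a b "\<lambda>q. lx (F (pt_of q (yc w1)))" "dlxflx F" "\<lambda>q. pt_of q (yc w1)" "Pset R z" CF])
    fix q assume "q \<in> closed_segment a b"
    then show "((\<lambda>q. lx (F (pt_of q (yc w1)))) has_derivative dlxflx F (pt_of q (yc w1))) (at q)"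
      "pt_of q (yc w1) \<in> Pset R z"
      using P Pset_subset der by blast+
  next
    fix p and j :: "(real^'c) \<times> (real^'u)" assume "p \<in> Pset R z" "j \<in> Basis"
    then show "norm (dlxflx F p j) \<le> CF" using partial_le(4)[of p j] Pset_subset[THEN subsetD, of p z] by simp
  qed
  have "inf_m_dlxflx * norm (b - a) \<le> norm (A (b - a))"
    using m_set_le[OF A(1), of "b - a"] inf_m_dlxflx_lower[OF z] by (meson mult_right_mono norm_ge_zero order_trans)
  then have 1: "inf_m_dlxflx * norm (lx w1 - lx w2) \<le> norm (lx (F w1) - lx (F (pt_of a (yc w1))))"
    using A(2) by (simp add: a_def b_def)
  have Y: "pt_of a y \<in> Dl R" if "y \<in> cball 0 R" for y using that w by (auto simp: mem_Dl a_def)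
  have "norm (lx (F (pt_of a (yc w1))) - lx (F (pt_of a (yc w2)))) \<le> sup_dyflx * norm (yc w1 - yc w2)"
  proof (rule differentiable_bound[where f="\<lambda>y. lx (F (pt_of a y))" and f'="\<lambda>y. dyflx F (pt_of a y)", OF convex_cball[of 0 R]])
    fix y :: "real^'s" assume y: "y \<in> cball 0 R"
    have pt_of_der': "((\<lambda>y. pt_of a y) has_derivative in_y) (at y within cball 0 R)"
      unfolding pt_of_def in_y_def[abs_def] by (auto intro!: derivative_eq_intros)
    show "((\<lambda>y. lx (F (pt_of a y))) has_derivative dyflx F (pt_of a y)) (at y within cball 0 R)"
      unfolding dyflx_def comp_def
      by (rule bounded_linear.has_derivative[OF bounded_linear_proj(4)
            has_derivative_compose[where f="\<lambda>y. pt_of a y" and g=F, OF pt_of_der' F_has_derivative[OF Y[OF y]]]])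
    show "onorm (dyflx F (pt_of a y)) \<le> sup_dyflx" using sup_dyflx_upper[OF Y[OF y]] .
  qed (use w in \<open>auto simp: mem_Dl\<close>)
  then have 2: "norm (lx (F (pt_of a (yc w1))) - lx (F w2)) \<le> sup_dyflx * norm (yc w1 - yc w2)"
    by (simp add: a_def)
  have "norm (lx (F w1) - lx (F (pt_of a (yc w1)))) \<le> norm (lx (F w1) - lx (F w2)) + norm (lx (F (pt_of a (yc w1))) - lx (F w2))"
    using norm_triangle_ineq4[of "lx (F w1) - lx (F w2)" "lx (F (pt_of a (yc w1))) - lx (F w2)"] by simp
  then show ?thesis using 1 2 by linarith
qed

end

subsection \<open>Cones and preimages of discs\<close>

locale stable_fibers = torus_map F R S
  for F :: "(real^'c::finite) \<times> (real^'u::finite) \<times> (real^'s::finite)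
              \<Rightarrow> (real^'c) \<times> (real^'u) \<times> (real^'s)"
    and R S +
  fixes L M :: real and k :: nat
  assumes R_small: "R < RLam / 2"
    and L_range: "2 * R / RLam < L" "L < 1"
    and cover: "covering_conditions R L F"
    and rate: "rate_conditions k R L F"
    and bcone: "backward_cone_conditions R L F"
    and M_range: "0 < M" "M < 1 / L"
    and ratio: "(infD R (\<lambda>z. m_set (ivmat (dlxflx F) (Pset R z)))
                   - 1 / M * supD R (\<lambda>p. onorm (dyflx F p)))
               / supD R (\<lambda>p. onorm (dyfy F p) + M * onorm (dlxfy F p)) > 1"
begin

lemma L_pos: "L > 0"
  using L_range R_pos by (simp add: RLam_def)

lemma R_L: "2 * R / L < RLam"
  using L_range L_pos by (simp add: RLam_def field_simps)

lemma M_R: "2 * R * M < RLam"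
  using mult_strict_left_mono[OF M_range(2), of "2 * R"] R_L R_pos by simp

lemma yc_diff_le: "p \<in> Dl R \<Longrightarrow> q \<in> Dl R \<Longrightarrow> norm (yc p - yc q) \<le> 2 * R"
  using norm_triangle_ineq4[of "yc p" "yc q"] by (simp add: mem_Dl)

lemma mu_less_xi_M: "\<mu> M < inf_m_dlxflx - 1 / M * sup_dyflx"
  using ratio mu_nonneg[of M] M_range
  unfolding \<mu>_def[symmetric] inf_m_dlxflx_def[symmetric] sup_dyflx_def[symmetric]
  \<comment> \<open>Division by zero yields 0, so \<open>ratio\<close> excludes
    \<open>\<mu> M = 0\<close> and the denominator can be cleared.\<close>
  by (cases "\<mu> M = 0") (auto simp: field_simps)

lemma mu_less_xi_L: "\<mu> (1 / L) < inf_m_dlxflx - L * sup_dyflx" and mu_L_less_1: "\<mu> (1 / L) < 1"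
  using rate by (auto simp: rate_conditions_def mu_s1_def \<mu>_def xi_cu1P_def inf_m_dlxflx_def sup_dyflx_def)

lemma xi_cu2_pos: "p \<in> Dl R \<Longrightarrow> 0 < mnorm (dlxflx F p) - 1 / L * onorm (dlxfy F p)"
proof -
  assume p: "p \<in> Dl R"
  have "0 < xi_cu2 R L F" using rate by (simp add: rate_conditions_def)
  also have "\<dots> \<le> mnorm (dlxflx F p) - 1 / L * onorm (dlxfy F p)"
    unfolding xi_cu2_def
  proof (rule infD_lower[OF p])
    fix q :: "('c, 'u, 's) pt" assume q: "q \<in> Dl R"
    have "0 - 1 / L * CF \<le> mnorm (dlxflx F q) - 1 / L * onorm (dlxfy F q)"
      using L_pos by (intro diff_mono mult_left_mono onorm_partial_le q mnorm_nonneg) simp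
    then show "- (1 / L * CF) \<le> mnorm (dlxflx F q) - 1 / L * onorm (dlxfy F q)" by simp
  qed
  finally show ?thesis .
qed

text \<open>By contraposition: off the cone the y-distance is below \<open>d / M\<close>, where
  \<open>d\<close> is the distance in (\<lambda>, x). The images are then at least \<xi>d apart in
  (\<lambda>, x), while M times their y-distance is at most \<mu>d < \<xi>d.\<close>

lemma M_cone_backward:
  assumes w: "w1 \<in> Dl R" "w2 \<in> Dl R" and l: "norm (lam w1 - lam w2) \<le> RLam"
    and F: "norm (lx (F w1) - lx (F w2)) \<le> M * norm (yc (F w1) - yc (F w2))"
  shows "norm (lx w1 - lx w2) \<le> M * norm (yc w1 - yc w2)"
proof (rule ccontr)
  assume neg: "\<not> ?thesis"
  define d where "d = norm (lx w1 - lx w2)"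
  have d: "M * norm (yc w1 - yc w2) < d" using neg by (simp add: d_def)
  then have d0: "d > 0" using M_range by (smt (verit) mult_nonneg_nonneg norm_ge_zero)
  have y: "norm (yc w1 - yc w2) \<le> d / M" using d M_range by (simp add: field_simps)
  have "inf_m_dlxflx * d - sup_dyflx * (d / M) \<le> inf_m_dlxflx * d - sup_dyflx * norm (yc w1 - yc w2)"
    using mult_left_mono[OF y sup_dyflx_nonneg] by linarith
  also have "\<dots> \<le> norm (lx (F w1) - lx (F w2))"
    unfolding d_def by (rule lx_estimate[OF w l])
  finally have "(inf_m_dlxflx - 1 / M * sup_dyflx) * d \<le> norm (lx (F w1) - lx (F w2))" by (simp add: algebra_simps)
  moreover have "norm (yc (F w1) - yc (F w2)) \<le> \<mu> M * (d / M)"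
    using M_range by (intro yc_estimate w y) (auto simp: d_def)
  then have "M * norm (yc (F w1) - yc (F w2)) \<le> \<mu> M * d"
    using M_range by (simp add: field_simps)
  moreover have "\<mu> M * d < (inf_m_dlxflx - 1 / M * sup_dyflx) * d"
    using mu_less_xi_M d0 by (rule mult_strict_right_mono)
  ultimately show False using F by linarith
qed

text \<open>At parameter 0 the homotopy is \<open>F\<close> up to translation, and \<open>w\<close>
  is the apex of its own cone. Its values lie in the chart ball, so the two avoidance conditions
  concern x and y alone.\<close>

lemma covering_at:
  assumes w: "w \<in> Dl R"
  shows "norm (xc w) = R \<Longrightarrow> norm (yc w) < R \<Longrightarrow> F w \<notin> Dl R"
    and "norm (xc (F w)) \<le> R \<Longrightarrow> norm (yc (F w)) \<noteq> R"
proof -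
  define U where "U = Ju_chart w (1 / L) \<inter> Dl R"
  have wU: "w \<in> U" using w by (simp add: U_def Ju_chart_def RLam_def ly_def)
  obtain lst and h :: "real \<Rightarrow> ('c, 'u, 's) pt \<Rightarrow> ('c, 'u, 's) pt" where
    b: "\<forall>a\<in>{0..1}. \<forall>w\<in>U. h a w \<in> ball lst RLam \<times> UNIV \<times> UNIV" and
    h0: "\<forall>w\<in>U. teq (h 0 w) (F w)" and
    ex: "\<forall>a\<in>{0..1}. \<forall>v\<in>U. (lam v \<in> cball (lam w) RLam \<and> xc v \<in> sphere 0 R \<and> yc v \<in> ball 0 R) \<longrightarrow>
             h a v \<notin> cball lst RLam \<times> cball 0 R \<times> cball 0 R" and
    ent: "\<forall>a\<in>{0..1}. \<forall>w\<in>U. h a w \<notin> cball lst RLam \<times> cball 0 R \<times> sphere 0 R"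
    using cover[unfolded covering_conditions_def Let_def, rule_format, OF w, folded U_def]
    by (elim exE conjE) (rule that; assumption)
  have eq: "xc (h 0 w) = xc (F w)" "yc (h 0 w) = yc (F w)"
    using h0 wU by (auto simp: teq_def)
  have l: "fst (h 0 w) \<in> cball lst RLam"
    using b wU by (force simp: mem_Times_iff)
  show "F w \<notin> Dl R" if "norm (xc w) = R" "norm (yc w) < R"
    using ex[rule_format, of 0 w] wU that l eq by (auto simp: mem_Times_iff mem_Dl xc_def yc_def RLam_def)
  show "norm (yc (F w)) \<noteq> R" if "norm (xc (F w)) \<le> R"
    using ent[rule_format, of 0 w] wU that l eq by (auto simp: mem_Times_iff xc_def yc_def)
qed

text \<open>The exit condition in the covering relation says nothing at the corner \<open>\<parallel>x\<parallel> = \<parallel>y\<parallel> = R\<close>. It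
  extends there by approaching the corner with \<open>y\<close> in the open ball, provided \<open>\<parallel>f\<^sub>x\<parallel> < R\<close>.\<close>
lemma exit_corner:
  assumes w: "w \<in> Dl R" and x: "norm (xc w) = R" and Fx: "norm (xc (F w)) < R"
  shows "norm (yc (F w)) > R"
proof (rule ccontr)
  assume "\<not> ?thesis"
  then have Fy: "norm (yc (F w)) < R" using covering_at(2)[OF w] Fx by linarith
  define v where "v t = pt_of (lx w) (t *\<^sub>R yc w)" for t
  have vw: "v 1 = w" by (simp add: v_def)
  have "(v \<longlongrightarrow> v 1) (at_left 1)"
    unfolding v_def pt_of_def by (intro tendsto_intros)
  then have lim: "((\<lambda>t. F (v t)) \<longlongrightarrow> F w) (at_left 1)"
    using isCont_tendsto_compose[OF isCont_F[OF w]] vw by simp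
  have "((\<lambda>t. norm (xc (F (v t)))) \<longlongrightarrow> norm (xc (F w))) (at_left 1)"
    by (intro tendsto_norm bounded_linear.tendsto[OF bounded_linear_proj(2)] lim)
  moreover have "((\<lambda>t. norm (yc (F (v t)))) \<longlongrightarrow> norm (yc (F w))) (at_left 1)"
    by (intro tendsto_norm bounded_linear.tendsto[OF bounded_linear_proj(3)] lim)
  ultimately have ev: "\<forall>\<^sub>F t in at_left 1. norm (xc (F (v t))) < R" "\<forall>\<^sub>F t in at_left 1. norm (yc (F (v t))) < R"
    using Fx Fy by (auto dest: order_tendstoD)
  have "\<forall>\<^sub>F t::real in at_left 1. t \<in> {0<..<1}"
    by (rule eventually_at_leftI[of 0]) auto
  with ev have "\<forall>\<^sub>F t::real in at_left 1. False"
  proof eventually_elim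
    case (elim t)
    have "norm (yc (v t)) = t * norm (yc w)" using elim by (simp add: v_def)
    also have "\<dots> \<le> t * R" using w elim by (simp add: mem_Dl)
    also have "\<dots> < R" using elim R_pos by simp
    finally have "norm (yc (v t)) < R" .
    moreover have "norm (xc (v t)) = R" using x by (simp add: v_def)
    ultimately show ?case
      using covering_at(1)[of "v t"] elim by (simp add: mem_Dl)
  qed
  then show False by simp
qed

lemma Wcs_Dl: "z \<in> Wcs R F \<Longrightarrow> (F ^^ n) z \<in> Dl R"
  by (simp add: Wcs_def)

lemma Wcs_F: "z \<in> Wcs R F \<Longrightarrow> F z \<in> Wcs R F"
  unfolding Wcs_def mem_Collect_eq by (metis funpow_Suc_right o_apply)

text \<open>Two iterates are needed. As an image, \<open>F z\<close> has y-norm below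
  \<open>R\<close>; as its own image lies in D, it then has x-norm below \<open>R\<close> as well.
  With \<open>norm (xc z) = R\<close> this contradicts \<open>exit_corner\<close>.\<close>

lemma Wcs_xc:
  assumes z: "z \<in> Wcs R F"
  shows "norm (xc z) < R"
proof (rule ccontr)
  assume neg: "\<not> ?thesis"
  have D: "z \<in> Dl R" "F z \<in> Dl R" "F (F z) \<in> Dl R"
    using Wcs_Dl[OF z, of 0] Wcs_Dl[OF Wcs_F[OF z], of 0] Wcs_Dl[OF Wcs_F[OF Wcs_F[OF z]], of 0] by auto
  then have x: "norm (xc z) = R" using neg by (simp add: mem_Dl)
  have "norm (yc (F z)) < R" using covering_at(2)[OF D(1)] D(2) by (simp add: mem_Dl order_less_le)
  then have "norm (xc (F z)) < R" using covering_at(1)[OF D(2)] D by (auto simp: mem_Dl order_less_le)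
  then show False using exit_corner[OF D(1) x] D(2) by (simp add: mem_Dl)
qed

text \<open>The intersection problem \<open>f\<^sub>\<lambda>\<^sub>x = b(f\<^sub>y)\<close> is nondegenerate in \<open>(\<lambda>, x)\<close> because \<open>\<xi>\<^sub>c\<^sub>u\<^sub>,\<^sub>2 > 0\<close>.\<close>
lemma graph_equation_locally_injective:
  assumes w: "w \<in> Dl R" and B: "\<And>y y'. norm (B y - B y') \<le> 1 / L * norm (y - y')"
  obtains d where "d > 0" "ball w d \<subseteq> S"
    "\<And>p q. \<lbrakk>p \<in> ball w d; q \<in> ball w d; yc p = yc q;
      lx (F p) - B (yc (F p)) = lx (F q) - B (yc (F q))\<rbrakk> \<Longrightarrow> p = q"
proof -
  define g where "g = mnorm (dlxflx F w) - 1 / L * onorm (dlxfy F w)"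
  \<comment> \<open>Weight of the remainder: 1 from its (\<lambda>, x)-part and 1/L from its y-part
    through \<open>B\<close>. Half of the gap \<open>g\<close> is spent on it.\<close>
  define c where "c = 1 + 1 / L"
  define e where "e = g / (2 * c)"
  have g: "g > 0" using xi_cu2_pos[OF w] by (simp add: g_def)
  have "c > 0" using L_pos by (simp add: c_def add_pos_pos)
  then have e: "e > 0" "e * c = g / 2" using g by (auto simp: e_def)
  have wS: "w \<in> S" using w D_S by blast
  obtain d where d: "d > 0" "ball w d \<subseteq> S"
    "\<And>q r. q \<in> ball w d \<Longrightarrow> r \<in> ball w d \<Longrightarrow> norm (F r - F q - DF F w (r - q)) \<le> e * norm (r - q)"
    using Ck_on_1_strict_derivative[OF C1 wS e(1)] DF_eq_jac[OF C1 wS] by metis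
  show thesis
  proof (rule that[OF d(1,2)])
    fix p q assume pq: "p \<in> ball w d" "q \<in> ball w d" and y: "yc p = yc q"
      and eq: "lx (F p) - B (yc (F p)) = lx (F q) - B (yc (F q))"
    define D where "D = norm (lx p - lx q)"
    define r where "r = F p - F q - DF F w (p - q)"
    have "norm (p - q) \<le> D" using norm_le_lx_yc[of "p - q"] y by (simp add: D_def)
    then have r: "norm r \<le> e * D" using d(3)[OF pq(2,1)] e(1) unfolding r_def
      by (meson mult_left_mono order_less_imp_le order_trans)
    have lin: "dyflx F w 0 = 0" "dyfy F w 0 = 0"
      using bounded_linear_partial[OF w] by (auto intro: linear_0 bounded_linear.linear)
    have "lx r = lx (F p) - lx (F q) - dlxflx F w (lx p - lx q)"
      using DF_split(2)[OF w, of "p - q"] y lin by (simp add: r_def)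
    then have "norm (dlxflx F w (lx p - lx q)) \<le> norm (lx (F p) - lx (F q)) + norm (lx r)"
      using norm_triangle_ineq4[of "lx (F p) - lx (F q)" "lx r"] by simp
    then have 1: "mnorm (dlxflx F w) * D \<le> norm (lx (F p) - lx (F q)) + e * D"
      using mnorm_mult_le[of "dlxflx F w" "lx p - lx q"] norm_proj_le(1)[of r] r by (simp add: D_def)
    have "yc r = yc (F p) - yc (F q) - dlxfy F w (lx p - lx q)"
      using DF_split(1)[OF w, of "p - q"] y lin by (simp add: r_def)
    then have "norm (yc (F p) - yc (F q)) \<le> norm (dlxfy F w (lx p - lx q)) + norm (yc r)"
      using norm_triangle_ineq[of "dlxfy F w (lx p - lx q)" "yc r"] by simp
    then have 2: "norm (yc (F p) - yc (F q)) \<le> onorm (dlxfy F w) * D + e * D"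
      using onorm[OF bounded_linear_partial(2)[OF w], of "lx p - lx q"] norm_proj_le(2)[of r] r by (simp add: D_def)
    have "lx (F p) - lx (F q) = B (yc (F p)) - B (yc (F q))" using eq by (simp add: algebra_simps)
    then have "norm (lx (F p) - lx (F q)) \<le> 1 / L * norm (yc (F p) - yc (F q))"
      using B by metis
    also have "\<dots> \<le> 1 / L * (onorm (dlxfy F w) * D + e * D)"
      using 2 L_pos by (intro mult_left_mono) auto
    finally have "mnorm (dlxflx F w) * D \<le> 1 / L * (onorm (dlxfy F w) * D + e * D) + e * D"
      using 1 by linarith
    then have "g * D \<le> (e * c) * D" by (simp add: g_def c_def algebra_simps)
    then have "g * D \<le> g / 2 * D" unfolding e(2) .
    then have "D \<le> 0" using g by (simp add: mult_le_cancel_right)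
    then show "p = q" using y by (intro pt_eqI) (auto simp: D_def)
  qed
qed

text \<open>Strictness of the x-bound is what allows \<open>exit_corner\<close> to be applied to
  preimages of points of the disc.\<close>

definition disc :: "(real^'s \<Rightarrow> (real^'c) \<times> (real^'u)) \<Rightarrow> bool" where
  "disc b \<longleftrightarrow> (\<forall>y\<in>cball 0 R. norm (snd (b y)) < R) \<and>
     (\<forall>y\<in>cball 0 R. \<forall>y'\<in>cball 0 R. norm (b y - b y') \<le> M * norm (y - y'))"

text \<open>Nearest-point projection onto the ball does not increase distances. The extension makes
  the preimage equation meaningful and continuous also where the image has y outside the
  ball.\<close>

lemma disc_extend:
  assumes b: "disc b"
  obtains B where "\<And>y. norm (snd (B y)) < R" "\<And>y y'. norm (B y - B y') \<le> M * norm (y - y')"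
    "\<And>y. y \<in> cball 0 R \<Longrightarrow> B y = b y"
proof
  let ?c = "closest_point (cball 0 R)"
  have c: "?c y \<in> cball 0 R" for y
    using R_pos by (intro closest_point_in_set) auto
  show "norm (snd (b (?c y))) < R" for y using b c[of y] unfolding disc_def by blast
  show "norm (b (?c y) - b (?c y')) \<le> M * norm (y - y')" for y y'
  proof -
    have "norm (b (?c y) - b (?c y')) \<le> M * norm (?c y - ?c y')" using b c[of y] c[of y'] unfolding disc_def by blast
    also have "\<dots> \<le> M * norm (y - y')"
      using closest_point_lipschitz[of "cball 0 R" y y'] M_range R_pos by (intro mult_left_mono) (auto simp: dist_norm)
    finally show ?thesis .
  qed
  show "b (?c y) = b y" if "y \<in> cball 0 R" for y using closest_point_self[OF that] by simp
qed

text \<open>A priori bounds for the continuation of preimages: closed constraints turn out to be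
  strict at every solution, the one on \<lambda> by the cone and \<open>M_R\<close>, those on x and
  on the y of the image by the covering condition.\<close>

lemma on_disc_preimage:
  assumes z: "z \<in> Dl R" and Fz: "F z \<in> Dl R" "lx (F z) = b (yc (F z))" and b: "disc b"
    and w: "w \<in> Dl R" "norm (lam w - lam z) \<le> RLam" and Fw: "F w \<in> Dl R" "lx (F w) = b (yc (F w))"
  shows "norm (lx w - lx z) \<le> M * norm (yc w - yc z)" "norm (lam w - lam z) \<le> 2 * R * M"
    "norm (xc w) < R" "norm (yc (F w)) < R"
proof -
  have y: "yc (F w) \<in> cball 0 R" "yc (F z) \<in> cball 0 R" using Fw Fz by (auto simp: mem_Dl)
  show 1: "norm (lx w - lx z) \<le> M * norm (yc w - yc z)"
  proof (rule M_cone_backward[OF w(1) z w(2)])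
    show "norm (lx (F w) - lx (F z)) \<le> M * norm (yc (F w) - yc (F z))"
      unfolding Fw(2) Fz(2) using b y by (simp add: disc_def)
  qed
  have "M * norm (yc w - yc z) \<le> M * (2 * R)"
    using yc_diff_le[OF w(1) z] M_range by (intro mult_left_mono) auto
  then show "norm (lam w - lam z) \<le> 2 * R * M"
    using norm_proj_le(3)[of "w - z"] 1 by (simp add: mult.commute mult.left_commute)
  show "norm (yc (F w)) < R"
    using covering_at(2)[OF w(1)] Fw(1) by (auto simp: mem_Dl order_less_le)
  have "norm (xc (F w)) < R" using b y(1) Fw(2) pt_of_simps(7)[of "F w"] unfolding disc_def by metis
  then show "norm (xc w) < R"
    using exit_corner[OF w(1)] w(1) Fw(1) by (fastforce simp: mem_Dl)
qed

text \<open>The set of \<open>y\<close> over which the equation is solvable is open by invariance of domain, closed by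
  compactness, and contains \<open>yc z\<close>. Solutions cannot leave the domain since they stay in the
  \<open>M\<close>-cone of \<open>z\<close> and, by the covering condition, off the exit set.\<close>
lemma disc_preimage_exists:
  assumes z: "z \<in> Dl R" and Fz: "F z \<in> Dl R" "lx (F z) = b (yc (F z))" and b: "disc b"
    and y: "y \<in> cball 0 R"
  obtains w where "w \<in> Dl R" "yc w = y" "norm (lam w - lam z) \<le> RLam" "F w \<in> Dl R" "lx (F w) = b (yc (F w))"
proof -
  obtain B where B: "\<And>y. norm (snd (B y)) < R" "\<And>y y'. norm (B y - B y') \<le> M * norm (y - y')"
    "\<And>y. y \<in> cball 0 R \<Longrightarrow> B y = b y" using disc_extend[OF b] by metis
  have BL: "norm (B y - B y') \<le> 1 / L * norm (y - y')" for y y'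
    using B(2)[of y y'] M_range by (meson less_imp_le mult_right_mono norm_ge_zero order_trans)
  have contB: "continuous_on UNIV B"
    using B(2) M_range by (intro lipschitz_on_continuous_on[of M] lipschitz_onI) (auto simp: dist_norm)
  define K where "K = cball (lam z) RLam \<times> (cball 0 R :: (real^'u) set) \<times> (cball 0 R :: (real^'s) set)"
  define f where "f w = (norm (yc (F w)), lx (F w) - B (yc (F w)))" for w
  \<comment> \<open>The equation itself bounds the x-part of \<open>F w\<close>, because
    \<open>B\<close> has x-part of norm below \<open>R\<close>.\<close>
  define G where "G = K \<inter> f -` ({..R} \<times> {0})"
  have G_iff: "w \<in> G \<longleftrightarrow> w \<in> Dl R \<and> norm (lam w - lam z) \<le> RLam \<and> norm (yc (F w)) \<le> R \<and> lx (F w) = B (yc (F w))" for w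
    by (auto simp: G_def K_def f_def mem_Dl mem_Times_iff lam_def xc_def yc_def dist_norm norm_minus_commute)
  have GD: "F w \<in> Dl R \<and> lx (F w) = b (yc (F w))" if "w \<in> G" for w
    using that B(1)[of "yc (F w)"] B(3)[of "yc (F w)"] pt_of_simps(7)[of "F w"] by (auto simp: G_iff mem_Dl)
  have contF: "continuous_on A F" if "A \<subseteq> S" for A
    using Ck_on_1D(2)[OF C1] that continuous_on_subset by blast
  have cont_proj: "continuous_on A (\<lambda>w. yc (F w))" "continuous_on A (\<lambda>w. lx (F w))" 
    "continuous_on A (\<lambda>w. B (yc (F w)))" if "A \<subseteq> S" for A
  proof -
    show 1: "continuous_on A (\<lambda>w. yc (F w))" and "continuous_on A (\<lambda>w. lx (F w))"
      using contF[OF that] bounded_linear_proj(3,4) by (auto intro: bounded_linear.continuous_on)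
    show "continuous_on A (\<lambda>w. B (yc (F w)))"
      by (rule continuous_on_compose2[OF contB 1]) simp
  qed
  have "compact K" by (simp add: K_def compact_Times)
  moreover have KS: "K \<subseteq> S" using D_S by (auto simp: K_def Dl_def)
  have "closed G"
    unfolding G_def
  proof (rule continuous_closed_preimage)
    show "continuous_on K f" unfolding f_def[abs_def]
      by (intro continuous_on_Pair continuous_on_norm continuous_on_diff cont_proj KS)
    show "closed K" using \<open>compact K\<close> by (rule compact_imp_closed)
  qed (intro closed_Times closed_atMost closed_singleton)
  ultimately have "compact G"
    using compact_Int_closed[of K G] by (simp add: G_def Int_absorb1 Int_assoc[symmetric])
  then have "compact (yc ` G)"
    by (intro compact_continuous_image linear_continuous_on bounded_linear_proj)
  moreover have sub: "yc ` G \<subseteq> cball 0 R" by (auto simp: G_iff mem_Dl)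
  ultimately have cl: "closedin (top_of_set (cball 0 R)) (yc ` G)"
    by (simp add: closed_subset compact_imp_closed)
  have op: "openin (top_of_set (cball 0 R)) (yc ` G)"
    unfolding openin_euclidean_subtopology_iff
  proof (intro conjI sub ballI)
    fix y assume "y \<in> yc ` G"
    then obtain w where w: "w \<in> G" "y = yc w" by blast
    have wD: "w \<in> Dl R" "norm (lam w - lam z) \<le> RLam" using w by (auto simp: G_iff)
    note on = on_disc_preimage[OF z Fz b wD]
    have wx: "norm (xc w) < R" "norm (yc (F w)) < R" "norm (lam w - lam z) < RLam"
      using on GD[OF w(1)] M_R by auto
    obtain d where d: "d > 0" "ball w d \<subseteq> S"
      "\<And>p q. \<lbrakk>p \<in> ball w d; q \<in> ball w d; yc p = yc q;
        lx (F p) - B (yc (F p)) = lx (F q) - B (yc (F q))\<rbrakk> \<Longrightarrow> p = q"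
      using graph_equation_locally_injective[OF wD(1), of B] BL by metis
    have nx: "\<forall>\<^sub>F p in nhds w. norm (g p) < c" if "isCont g w" "norm (g w) < c" for g :: "_ \<Rightarrow> 'z::real_normed_vector" and c
      using order_tendstoD(2)[OF tendsto_norm[OF that(1)[unfolded continuous_at tendsto_at_iff_tendsto_nhds]] that(2)] .
    \<comment> \<open>No bound on y here: \<open>yc w\<close> may lie on the sphere, and then the
      neighbourhood reaches outside D, though not outside \<open>S\<close>.\<close>
    have "\<forall>\<^sub>F p in nhds w. norm (xc p) < R \<and> norm (yc (F p)) < R \<and> norm (lam p - lam z) < RLam"
      by (intro eventually_conj nx wx continuous_intros isCont_F wD
          bounded_linear.isCont[OF bounded_linear_proj(1)] bounded_linear.isCont[OF bounded_linear_proj(2)]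
          bounded_linear.isCont[OF bounded_linear_proj(3)])
    then obtain d' where d': "d' > 0" "\<And>p. dist p w < d' \<Longrightarrow> norm (xc p) < R \<and> norm (yc (F p)) < R \<and> norm (lam p - lam z) < RLam"
      unfolding eventually_nhds_metric by blast
    define N where "N = ball w (min d d')"
    \<comment> \<open>\<open>\<Theta>\<close> records the defect of the equation together with y. A
      point sent to \<open>pt_of 0 y'\<close> solves the equation over \<open>y'\<close>, so an open
      image gives solutions over all nearby \<open>y'\<close>.\<close>
    define \<Theta> where "\<Theta> p = pt_of (lx (F p) - B (yc (F p))) (yc p)" for p
    have N: "w \<in> N" "open N" "N \<subseteq> S" using d d' by (auto simp: N_def)
    have "open (\<Theta> ` N)"
    proof (rule invariance_of_domain)
      show "continuous_on N \<Theta>"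
        unfolding \<Theta>_def[abs_def] pt_of_def
        by (intro continuous_on_Pair continuous_on_fst continuous_on_snd continuous_on_diff cont_proj N
            linear_continuous_on bounded_linear_proj)
      show "inj_on \<Theta> N"
      proof (rule inj_onI)
        fix p q assume pq: "p \<in> N" "q \<in> N" and eq: "\<Theta> p = \<Theta> q"
        have "yc p = yc q" "lx (F p) - B (yc (F p)) = lx (F q) - B (yc (F q))"
          using arg_cong[OF eq, of yc] arg_cong[OF eq, of lx] by (simp_all add: \<Theta>_def)
        then show "p = q" using d(3)[of p q] pq by (simp add: N_def)
      qed
    qed (fact N)
    moreover have "pt_of 0 y \<in> \<Theta> ` N"
      using w N by (intro image_eqI[of _ _ w]) (auto simp: \<Theta>_def G_iff)
    ultimately obtain e where e: "e > 0" "ball (pt_of 0 y) e \<subseteq> \<Theta> ` N"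
      by (meson open_contains_ball)
    show "\<exists>e>0. \<forall>y'\<in>cball 0 R. dist y' y < e \<longrightarrow> y' \<in> yc ` G"
    proof (intro exI conjI ballI impI)
      fix y' :: "real^'s" assume y': "y' \<in> cball 0 R" "dist y' y < e"
      have "dist (pt_of 0 y) (pt_of 0 y' :: ('c, 'u, 's) pt) < e"
        using y'(2) norm_le_lx_yc[of "pt_of 0 y - (pt_of 0 y' :: ('c, 'u, 's) pt)"] by (simp add: dist_norm norm_minus_commute)
      then have "pt_of 0 y' \<in> \<Theta> ` N" using e by auto
      then obtain p where p: "p \<in> N" "\<Theta> p = pt_of 0 y'" by auto
      have "yc p = y'" "lx (F p) = B (yc (F p))"
        using arg_cong[OF p(2), of yc] arg_cong[OF p(2), of lx] by (auto simp: \<Theta>_def)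
      moreover have "norm (xc p) < R \<and> norm (yc (F p)) < R \<and> norm (lam p - lam z) < RLam"
        using p(1) d'(2)[of p] by (simp add: N_def dist_commute)
      ultimately have "p \<in> G" using y' by (simp add: G_iff mem_Dl)
      then show "y' \<in> yc ` G" using \<open>yc p = y'\<close> by blast
    qed (fact e)
  qed
  have "z \<in> G" using z Fz B(3)[of "yc (F z)"] by (simp add: G_iff mem_Dl RLam_def)
  then have "yc ` G = cball 0 R"
    using convex_connected[OF convex_cball, of 0 R] cl op unfolding connected_clopen by blast
  then obtain w where "w \<in> G" "yc w = y" using y by (metis imageE)
  then show thesis using that GD G_iff by blast
qed

end

subsection \<open>Stable fibres\<close>

context stable_fibers
begin

text \<open>Pairs in the preimage may lie in different charts, where the cone estimate does not apply.
  Hence the Lipschitz bound is propagated outwards from \<open>yc z\<close> in steps of length \<open>\<epsilon>\<close>: points over the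
  larger ball are \<open>M * \<epsilon>\<close>-close to points over the smaller ball, which keeps each pair in one chart.\<close>
lemma graph_transform:
  assumes z: "z \<in> Dl R" and Fz: "F z \<in> Dl R" "lx (F z) = b (yc (F z))" and b: "disc b"
  obtains b' where "disc b'" "b' (yc z) = lx z"
    "\<And>y. y \<in> cball 0 R \<Longrightarrow> F (pt_of (b' y) y) \<in> Dl R \<and> lx (F (pt_of (b' y) y)) = b (yc (F (pt_of (b' y) y)))"
proof -
  define G where "G = {w \<in> Dl R. norm (lam w - lam z) \<le> RLam \<and> F w \<in> Dl R \<and> lx (F w) = b (yc (F w))}"
  have GD: "w \<in> Dl R" "norm (lam w - lam z) \<le> RLam" "F w \<in> Dl R" "lx (F w) = b (yc (F w))" if "w \<in> G" for w
    using that by (auto simp: G_def)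
  have zG: "z \<in> G" using z Fz by (simp add: G_def RLam_def)
  have G: "norm (lx w - lx z) \<le> M * norm (yc w - yc z)" "norm (lam w - lam z) \<le> 2 * R * M" "norm (xc w) < R"
    if "w \<in> G" for w
    using on_disc_preimage[OF z Fz b GD[OF that]] by auto
  \<comment> \<open>Two points at distance at most 2RM, each displaced by at most
    \<open>M * \<epsilon>\<close>, stay within \<open>RLam\<close> of each other; the surplus is
    used up exactly.\<close>
  define \<epsilon> where "\<epsilon> = (RLam - 2 * R * M) / (2 * M)"
  have "(2 * M) * \<epsilon> = RLam - 2 * R * M" using M_range by (simp add: \<epsilon>_def)
  then have "2 * (M * \<epsilon>) + 2 * R * M = RLam" by simp
  moreover have "\<epsilon> > 0" using M_R M_range by (simp add: \<epsilon>_def)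
  ultimately have eps: "\<epsilon> > 0" "2 * (M * \<epsilon>) + 2 * R * M = RLam" by blast+
  have pull: "\<exists>v\<in>G. norm (yc v - yc z) \<le> real n * \<epsilon> \<and> norm (lx w - lx v) \<le> M * \<epsilon>"
    if w: "w \<in> G" and y: "norm (yc w - yc z) \<le> real (Suc n) * \<epsilon>" for w n
  proof -
    \<comment> \<open>Moving back from \<open>yc w\<close> towards \<open>yc z\<close> by the
      fraction 1/(n+1) costs at most \<open>\<epsilon>\<close> and leaves at most n steps.\<close>
    define s where "s = real n / real (Suc n)"
    have s: "0 \<le> s" "s \<le> 1" "s * real (Suc n) = real n" "(1 - s) * real (Suc n) = 1"
      by (auto simp: s_def field_simps)
    define y' where "y' = (1 - s) *\<^sub>R yc z + s *\<^sub>R yc w"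
    have y': "y' \<in> cball 0 R"
      unfolding y'_def using GD(1)[OF w] z s by (intro convexD_alt[OF convex_cball]) (auto simp: mem_Dl)
    \<comment> \<open>Continuation is restarted from \<open>w\<close> instead of \<open>z\<close>,
      so that the cone estimate compares \<open>v\<close> with \<open>w\<close> directly.\<close>
    obtain v where v: "v \<in> Dl R" "yc v = y'" "norm (lam v - lam w) \<le> RLam" "F v \<in> Dl R" "lx (F v) = b (yc (F v))"
      using disc_preimage_exists[OF GD(1,3,4)[OF w] b y'] by metis
    have "y' - yc w = (1 - s) *\<^sub>R (yc z - yc w)" by (simp add: y'_def algebra_simps)
    then have "norm (y' - yc w) = (1 - s) * norm (yc w - yc z)" using s by (simp add: norm_minus_commute)
    also have "\<dots> \<le> (1 - s) * (real (Suc n) * \<epsilon>)" using y s by (intro mult_left_mono) auto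
    also have "\<dots> = \<epsilon>" using s(4) by (metis mult.assoc mult_1)
    finally have "norm (y' - yc w) \<le> \<epsilon>" .
    then have "M * norm (yc v - yc w) \<le> M * \<epsilon>" using M_range v(2) by simp
    then have lv: "norm (lx v - lx w) \<le> M * \<epsilon>"
      using on_disc_preimage(1)[OF GD(1,3,4)[OF w] b v(1,3,4,5)] by linarith
    have "norm (lam v - lam z) \<le> norm (lam v - lam w) + norm (lam w - lam z)"
      using norm_triangle_ineq[of "lam v - lam w" "lam w - lam z"] by simp
    also have "\<dots> \<le> M * \<epsilon> + 2 * R * M"
      using lv norm_proj_le(3)[of "v - w"] G(2)[OF w] by simp
    also have "\<dots> \<le> RLam" using eps M_range by (smt (verit) mult_pos_pos)
    finally have vG: "v \<in> G" using v by (simp add: G_def)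
    have "y' - yc z = s *\<^sub>R (yc w - yc z)" by (simp add: y'_def algebra_simps)
    then have "norm (y' - yc z) = s * norm (yc w - yc z)" using s by simp
    also have "\<dots> \<le> s * (real (Suc n) * \<epsilon>)" using y s by (intro mult_left_mono) auto
    also have "\<dots> = real n * \<epsilon>" using s(3) by (metis mult.assoc)
    finally show ?thesis using vG v(2) lv by (metis norm_minus_commute)
  qed
  have chain: "norm (lx w1 - lx w2) \<le> M * norm (yc w1 - yc w2)"
    if "w1 \<in> G" "w2 \<in> G" "norm (yc w1 - yc z) \<le> real n * \<epsilon>" "norm (yc w2 - yc z) \<le> real n * \<epsilon>" for w1 w2 n
    using that
  proof (induction n arbitrary: w1 w2)
    case 0
    then show ?case using G(1)[of w1] G(1)[of w2] by simp
  next
    case (Suc n)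
    obtain v1 v2 where v: "v1 \<in> G" "norm (yc v1 - yc z) \<le> real n * \<epsilon>" "norm (lx w1 - lx v1) \<le> M * \<epsilon>"
      "v2 \<in> G" "norm (yc v2 - yc z) \<le> real n * \<epsilon>" "norm (lx w2 - lx v2) \<le> M * \<epsilon>"
      using pull[OF Suc.prems(1,3)] pull[OF Suc.prems(2,4)] by blast
    have "norm (lx v1 - lx v2) \<le> M * norm (yc v1 - yc v2)" using Suc.IH v by blast
    also have "\<dots> \<le> M * (2 * R)" using yc_diff_le[OF GD(1)[OF v(1)] GD(1)[OF v(4)]] M_range by simp
    finally have "norm (lx w1 - lx w2) \<le> RLam"
      using v(3,6) eps(2) norm_triangle_ineq[of "lx w1 - lx v1" "lx v1 - lx v2"]
        norm_triangle_ineq4[of "lx w1 - lx v2" "lx w2 - lx v2"] by (simp add: algebra_simps)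
    then have "norm (lam w1 - lam w2) \<le> RLam" using norm_proj_le(3)[of "w1 - w2"] by simp
    then show ?case
    proof (rule M_cone_backward[OF GD(1)[OF Suc.prems(1)] GD(1)[OF Suc.prems(2)]])
      show "norm (lx (F w1) - lx (F w2)) \<le> M * norm (yc (F w1) - yc (F w2))"
        using b GD(3,4)[OF Suc.prems(1)] GD(3,4)[OF Suc.prems(2)] by (simp add: disc_def mem_Dl)
    qed
  qed
  obtain n :: nat where n: "2 * R \<le> real n * \<epsilon>"
    using reals_Archimedean3[OF eps(1), rule_format, of "2 * R"] less_imp_le by blast
  have lip: "norm (lx w1 - lx w2) \<le> M * norm (yc w1 - yc w2)" if "w1 \<in> G" "w2 \<in> G" for w1 w2
    using chain[OF that, of n] yc_diff_le[OF GD(1) z] that n by (meson order_trans)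
  have "\<exists>a. pt_of a y \<in> G" if y: "y \<in> cball 0 R" for y
  proof -
    obtain w where "w \<in> G" "yc w = y"
      using disc_preimage_exists[OF z Fz b y] unfolding G_def by blast
    then show ?thesis by (metis pt_of_simps(5))
  qed
  then obtain b' where b': "\<And>y. y \<in> cball 0 R \<Longrightarrow> pt_of (b' y) y \<in> G" by metis
  show thesis
  proof
    show "disc b'"
      unfolding disc_def using b' lip[OF b' b'] G(3)[OF b'] by simp
    have "yc z \<in> cball 0 R" using z by (simp add: mem_Dl)
    from G(1)[OF b'[OF this]] show "b' (yc z) = lx z" by simp
    show "\<And>y. y \<in> cball 0 R \<Longrightarrow> F (pt_of (b' y) y) \<in> Dl R \<and> lx (F (pt_of (b' y) y)) = b (yc (F (pt_of (b' y) y)))"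
      using GD(3,4)[OF b'] by blast
  qed
qed

section \<open>Discs that follow the orbit for a finite time, and their limits\<close>

lemma disc_in_cone:
  assumes "disc b" "z \<in> Dl R" "b (yc z) = lx z" "y \<in> cball 0 R"
  shows "pt_of (b y) y \<in> Dl R \<inter> Js_chart z M"
proof -
  have "yc z \<in> cball 0 R" using assms(2) by (simp add: mem_Dl)
  then have "norm (b y - b (yc z)) \<le> M * norm (y - yc z)" "norm (snd (b y)) < R"
    using assms(1,4) unfolding disc_def by blast+
  moreover from this(2) have D: "pt_of (b y) y \<in> Dl R" using assms(4) by (simp add: mem_Dl)
  moreover have "M * norm (y - yc z) \<le> M * (2 * R)"
    using yc_diff_le[OF D assms(2)] M_range by (intro mult_left_mono) auto
  moreover have "norm (fst (b y) - lam z) \<le> norm (b y - lx z)"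
    using norm_proj_le(3)[of "pt_of (b y) y - z"] by simp
  ultimately show ?thesis
    using assms(3) M_R by (simp add: Js_chart_def mult.commute mult.left_commute)
qed

text \<open>The image of a point on the pulled-back disc lies on the disc through
  \<open>F z\<close>. Each disc is an M-Lipschitz graph through a point of the orbit, hence lies in
  the M-cone of that point.\<close>

lemma finite_time_disc:
  assumes "z \<in> Wcs R F"
  shows "\<exists>b. disc b \<and> b (yc z) = lx z \<and>
    (\<forall>y\<in>cball 0 R. \<forall>i\<le>n. (F ^^ i) (pt_of (b y) y) \<in> Dl R \<inter> Js_chart ((F ^^ i) z) M)"
  using assms
proof (induction n arbitrary: z)
  case 0
  have z: "z \<in> Dl R" using Wcs_Dl[OF 0, of 0] by simp
  have "disc (\<lambda>_. lx z)" using Wcs_xc[OF 0] M_range by (simp add: disc_def)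
  then show ?case using disc_in_cone[of "\<lambda>_. lx z", OF _ z] by (intro exI[of _ "\<lambda>_. lx z"]) simp
next
  case (Suc n)
  have z: "z \<in> Dl R" "F z \<in> Dl R" using Wcs_Dl[OF Suc.prems, of 0] Wcs_Dl[OF Suc.prems, of 1] by auto
  obtain b where b: "disc b" "b (yc (F z)) = lx (F z)"
    "\<And>y i. y \<in> cball 0 R \<Longrightarrow> i \<le> n \<Longrightarrow> (F ^^ i) (pt_of (b y) y) \<in> Dl R \<inter> Js_chart ((F ^^ i) (F z)) M"
    using Suc.IH[OF Wcs_F[OF Suc.prems]] by blast
  obtain b' where b': "disc b'" "b' (yc z) = lx z"
    "\<And>y. y \<in> cball 0 R \<Longrightarrow> F (pt_of (b' y) y) \<in> Dl R \<and> lx (F (pt_of (b' y) y)) = b (yc (F (pt_of (b' y) y)))"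
    using graph_transform[OF z b(2)[symmetric] b(1)] by metis
  have "(F ^^ i) (pt_of (b' y) y) \<in> Dl R \<inter> Js_chart ((F ^^ i) z) M" if y: "y \<in> cball 0 R" and i: "i \<le> Suc n" for y i
  proof (cases i)
    case 0
    then show ?thesis using disc_in_cone[OF b'(1) z(1) b'(2) y] by simp
  next
    case (Suc j)
    define y1 where "y1 = yc (F (pt_of (b' y) y))"
    have "F (pt_of (b' y) y) = pt_of (b y1) y1" "y1 \<in> cball 0 R"
      using b'(3)[OF y] unfolding y1_def by (metis pt_of_simps(5), simp add: mem_Dl)
    then show ?thesis
      using b(3)[of y1 j] i Suc by (simp add: funpow_Suc_right del: funpow.simps)
  qed
  then show ?case using b' by blast
qed

lemma Js_chart_mono: "w \<in> Js_chart z M \<Longrightarrow> w \<in> Js_chart z (1 / L)"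
  using mult_right_mono[of M "1 / L" "norm (yc w - yc z)"] M_range unfolding Js_chart_def by simp

lemma closed_Js_chart: "closed (Js_chart z c)"
proof -
  have "closed ({w. norm (lam w - lam z) \<le> RLam} \<inter> {w. norm (lx w - lx z) \<le> c * norm (yc w - yc z)})"
    by (intro closed_Int closed_Collect_le continuous_intros linear_continuous_on bounded_linear_proj)
  moreover have "Js_chart z c = {w. norm (lam w - lam z) \<le> RLam} \<inter> {w. norm (lx w - lx z) \<le> c * norm (yc w - yc z)}"
    by (auto simp: Js_chart_def)
  ultimately show ?thesis by simp
qed

text \<open>The condition at time \<open>i\<close> is closed and holds for all
  \<open>n \<ge> i\<close>. Continuity of \<open>F\<close> is available at points of D, so the limit
  at time \<open>i\<close> is placed in D before the next iterate is treated.\<close>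

lemma limit_in_Ws:
  assumes q: "\<And>n i. i \<le> n \<Longrightarrow> (F ^^ i) (q n) \<in> Dl R \<inter> Js_chart ((F ^^ i) z) M" and lim: "q \<longlonglongrightarrow> p"
  shows "p \<in> Ws R L F z"
proof -
  have mem: "l \<in> Dl R \<inter> Js_chart ((F ^^ i) z) M" if "(\<lambda>n. (F ^^ i) (q n)) \<longlonglongrightarrow> l" for i l
  proof (rule Lim_in_closed_set[OF closed_Int[OF closed_Dl closed_Js_chart] _ _ that])
    show "\<forall>\<^sub>F n in sequentially. (F ^^ i) (q n) \<in> Dl R \<inter> Js_chart ((F ^^ i) z) M"
      using eventually_ge_at_top[of i] by eventually_elim (rule q)
  qed simp
  have lim_i: "(\<lambda>n. (F ^^ i) (q n)) \<longlonglongrightarrow> (F ^^ i) p" for i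
  proof (induction i)
    case 0
    then show ?case using lim by simp
  next
    case (Suc i)
    then show ?case using isCont_tendsto_compose[OF isCont_F Suc] mem[OF Suc] by simp
  qed
  have "(F ^^ i) p \<in> Dl R \<inter> Js_chart ((F ^^ i) z) M" for i by (rule mem[OF lim_i])
  then have "(F ^^ i) p \<in> Dl R" "(F ^^ i) p \<in> Js ((F ^^ i) z) (1 / L)" for i
    unfolding Js_iff using Js_chart_mono teq_refl by blast+
  then show ?thesis unfolding Ws_def using \<open>\<And>i. (F ^^ i) p \<in> Dl R\<close>[of 0] by auto
qed

text \<open>Convergence of whole discs is avoided: compactness is applied to the pair of values over
  \<open>y1\<close> and \<open>y2\<close>, and the Lipschitz bound within a single disc survives in
  the limit.\<close>

lemma Ws_pair_exists:
  assumes z: "z \<in> Wcs R F" and y: "y1 \<in> cball 0 R" "y2 \<in> cball 0 R"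
  obtains a1 a2 where "pt_of a1 y1 \<in> Ws R L F z" "pt_of a2 y2 \<in> Ws R L F z" "norm (a1 - a2) \<le> M * norm (y1 - y2)"
proof -
  obtain b where b: "\<And>n. disc (b n)" "\<And>n. b n (yc z) = lx z" "\<And>n y i. y \<in> cball 0 R \<Longrightarrow> i \<le> n \<Longrightarrow>
      (F ^^ i) (pt_of (b n y) y) \<in> Dl R \<inter> Js_chart ((F ^^ i) z) M"
    using finite_time_disc[OF z] by metis
  have zD: "z \<in> Dl R" using Wcs_Dl[OF z, of 0] by simp
  have "b n y \<in> cball (lx z) RLam" if "y \<in> cball 0 R" for n y
  proof -
    have D: "pt_of (b n y) y \<in> Dl R \<inter> Js_chart z M" by (rule disc_in_cone[OF b(1) zD b(2) that])
    then have "M * norm (y - yc z) \<le> M * (2 * R)"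
      using yc_diff_le[OF _ zD, of "pt_of (b n y) y"] M_range by (intro mult_left_mono) auto
    then show ?thesis using D M_R by (simp add: Js_chart_def dist_norm norm_minus_commute mult.commute mult.left_commute)
  qed
  then have mem: "\<forall>n. (b n y1, b n y2) \<in> cball (lx z) RLam \<times> cball (lx z) RLam" using y by blast
  have "seq_compact (cball (lx z) RLam \<times> cball (lx z) RLam)"
    by (simp add: compact_eq_seq_compact_metric[symmetric] compact_Times)
  from this mem obtain a and r :: "nat \<Rightarrow> nat" where "a \<in> cball (lx z) RLam \<times> cball (lx z) RLam"
    and r: "strict_mono r" and "((\<lambda>n. (b n y1, b n y2)) \<circ> r) \<longlonglongrightarrow> a"
    by (rule seq_compactE)
  then have a: "(\<lambda>n. b (r n) y1) \<longlonglongrightarrow> fst a" "(\<lambda>n. b (r n) y2) \<longlonglongrightarrow> snd a"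
    using tendsto_fst[of "(\<lambda>n. (b n y1, b n y2)) \<circ> r" a] tendsto_snd[of "(\<lambda>n. (b n y1, b n y2)) \<circ> r" a]
    by (auto simp: comp_def)
  have W: "pt_of l y \<in> Ws R L F z" if "y \<in> cball 0 R" "(\<lambda>n. b (r n) y) \<longlonglongrightarrow> l" for l y
  proof (rule limit_in_Ws)
    show "(\<lambda>n. pt_of (b (r n) y) y) \<longlonglongrightarrow> pt_of l y"
      unfolding pt_of_def using that(2) by (intro tendsto_intros)
    show "(F ^^ i) (pt_of (b (r n) y) y) \<in> Dl R \<inter> Js_chart ((F ^^ i) z) M" if "i \<le> n" for i n
      using b(3)[OF \<open>y \<in> cball 0 R\<close>, of i "r n"] that seq_suble[OF r, of n] by simp
  qed
  have "(\<lambda>n. norm (b (r n) y1 - b (r n) y2)) \<longlonglongrightarrow> norm (fst a - snd a)"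
    by (intro tendsto_intros a)
  moreover have "norm (b (r n) y1 - b (r n) y2) \<le> M * norm (y1 - y2)" for n
    using b(1)[of "r n"] y unfolding disc_def by blast
  ultimately have "norm (fst a - snd a) \<le> M * norm (y1 - y2)"
    by (meson LIMSEQ_le_const2)
  then show thesis using that W y a by blast
qed

text \<open>The cone bound holds for a lift in the chart of \<open>(F ^^ n) z\<close>, and y does
  not depend on the lift, so lifts can be changed at each step.\<close>

lemma Ws_contraction:
  assumes z: "z \<in> Wcs R F" and p: "p \<in> Ws R L F z"
  shows "norm (yc ((F ^^ n) p) - yc ((F ^^ n) z)) \<le> 2 * R * \<mu> (1 / L) ^ n"
proof (induction n)
  case 0
  have "p \<in> Dl R" "z \<in> Dl R" using p Wcs_Dl[OF z, of 0] by (auto simp: Ws_def)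
  then show ?case using yc_diff_le by simp
next
  case (Suc n)
  let ?p = "(F ^^ n) p" and ?z = "(F ^^ n) z"
  have D: "?p \<in> Dl R" "?z \<in> Dl R" using p Wcs_Dl[OF z] by (auto simp: Ws_def)
  have "?p \<in> Js ?z (1 / L)" using p by (simp add: Ws_def)
  then obtain q where q: "teq q ?p" "q \<in> Js_chart ?z (1 / L)" unfolding Js_iff by blast
  have qD: "q \<in> Dl R" using D(1) teq_Dl[OF q(1)] by simp
  have yq: "yc q = yc ?p" using q(1) by (simp add: teq_def)
  have "norm (yc (F q) - yc (F ?z)) \<le> \<mu> (1 / L) * norm (yc q - yc ?z)"
    using q(2) L_pos by (intro yc_estimate qD D) (auto simp: Js_chart_def)
  also have "\<dots> \<le> \<mu> (1 / L) * (2 * R * \<mu> (1 / L) ^ n)"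
    using Suc yq L_pos mu_nonneg[of "1 / L"] by (intro mult_left_mono) auto
  finally show ?case
    using F_teq[OF qD q(1)] by (simp add: teq_def algebra_simps)
qed

text \<open>Two points of \<open>W\<^sup>s\<^sub>z\<close> over the same \<open>y\<close> stay outside each other's stable cone, so their
  \<open>(\<lambda>, x)\<close>-distance grows at rate \<open>\<xi>\<^sub>c\<^sub>u\<^sub>,\<^sub>1\<^sub>,\<^sub>P\<close>, while both approach the orbit of \<open>z\<close> at the smaller rate \<open>\<mu>\<^sub>s\<^sub>,\<^sub>1\<close>.\<close>
lemma Ws_unique:
  assumes z: "z \<in> Wcs R F" and p1: "p1 \<in> Ws R L F z" and p2: "p2 \<in> Ws R L F z" and y: "yc p1 = yc p2"
  shows "teq p1 p2"
proof (rule ccontr)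
  assume neq: "\<not> teq p1 p2"
  define P Q Z where "P n = (F ^^ n) p1" and "Q n = (F ^^ n) p2" and "Z n = (F ^^ n) z" for n
  have D: "P n \<in> Dl R" "Q n \<in> Dl R" "Z n \<in> Dl R" for n
    using p1 p2 Wcs_Dl[OF z] by (auto simp: Ws_def P_def Q_def Z_def)
  have step: "P (Suc n) = F (P n)" "Q (Suc n) = F (Q n)" for n by (simp_all add: P_def Q_def)
  have out: "P n \<notin> Js (Q n) (1 / L)" for n
  proof (induction n)
    case 0
    show ?case
    proof
      assume "P 0 \<in> Js (Q 0) (1 / L)"
      then obtain q where q: "teq q p1" "q \<in> Js_chart p2 (1 / L)" unfolding Js_iff P_def Q_def by auto
      then have "yc q = yc p2" using y by (simp add: teq_def)
      then have "q = p2" using q(2) by (intro pt_eqI) (auto simp: Js_chart_def)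
      then show False using q(1) neq teq_sym by blast
    qed
  next
    case (Suc n)
    then show ?case using bcone D step unfolding backward_cone_conditions_def by metis
  qed
  define s where "s = \<mu> (1 / L)"
  define \<xi> where "\<xi> = inf_m_dlxflx - L * sup_dyflx"
  have s: "0 \<le> s" "s < 1" "s < \<xi>"
    using mu_nonneg[of "1 / L"] mu_L_less_1 mu_less_xi_L L_pos by (auto simp: s_def \<xi>_def)
  \<comment> \<open>Up to the factor \<open>s ^ n\<close>, each of the two points is within 2R/L in
    (\<lambda>, x) and 2R in y of the orbit of \<open>z\<close>.\<close>
  define K where "K = 4 * R / L + 4 * R"
  have K: "K > 0" using R_pos L_pos by (simp add: K_def add_pos_pos)
  have "\<exists>v. teq v (P n) \<and> norm (v - Q n) \<le> K * s ^ n" for n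
  proof -
    have "P n \<in> Js (Z n) (1 / L)" "Q n \<in> Js (Z n) (1 / L)"
      using p1 p2 by (auto simp: Ws_def P_def Q_def Z_def)
    then obtain q1 q2 where q: "teq q1 (P n)" "q1 \<in> Js_chart (Z n) (1 / L)" "teq q2 (Q n)" "q2 \<in> Js_chart (Z n) (1 / L)"
      unfolding Js_iff by blast
    obtain m where m: "intvec m" "q2 = shiftl m (Q n)" using q(3) unfolding teq_iff by blast
    \<comment> \<open>The shift that returns \<open>q2\<close> to \<open>Q n\<close> is applied to
      \<open>q1\<close> too, which preserves their difference.\<close>
    define v where "v = shiftl (- m) q1"
    have "teq v q1" using m(1) unfolding v_def teq_iff by (blast intro: intvec_minus)
    then have vP: "teq v (P n)" using q(1) teq_trans by blast
    have vq: "v - Q n = q1 - q2" by (simp add: v_def m(2) shiftl_def prod_eq_iff)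
    have yq: "norm (yc q1 - yc (Z n)) \<le> 2 * R * s ^ n" "norm (yc q2 - yc (Z n)) \<le> 2 * R * s ^ n"
      using Ws_contraction[OF z p1, of n] Ws_contraction[OF z p2, of n] q(1,3)
      by (auto simp: teq_def P_def Q_def Z_def s_def)
    have lq: "norm (lx q - lx (Z n)) \<le> 2 * R / L * s ^ n"
      if "q \<in> Js_chart (Z n) (1 / L)" "norm (yc q - yc (Z n)) \<le> 2 * R * s ^ n" for q
    proof -
      have "norm (lx q - lx (Z n)) \<le> 1 / L * norm (yc q - yc (Z n))" using that by (simp add: Js_chart_def)
      also have "\<dots> \<le> 1 / L * (2 * R * s ^ n)" using that L_pos by (intro mult_left_mono) auto
      finally show ?thesis by simp
    qed
    have "norm (q1 - q2) \<le> norm (lx q1 - lx q2) + norm (yc q1 - yc q2)"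
      using norm_le_lx_yc[of "q1 - q2"] by simp
    also have "\<dots> \<le> (2 * R / L * s ^ n + 2 * R / L * s ^ n) + (2 * R * s ^ n + 2 * R * s ^ n)"
      using norm_triangle_ineq4[of "lx q1 - lx (Z n)" "lx q2 - lx (Z n)"] norm_triangle_ineq4[of "yc q1 - yc (Z n)" "yc q2 - yc (Z n)"]
        lq[OF q(2) yq(1)] lq[OF q(4) yq(2)] yq by simp
    also have "\<dots> = K * s ^ n" by (simp add: K_def field_simps)
    finally show ?thesis using vq vP by metis
  qed
  then obtain v where v: "\<And>n. teq (v n) (P n)" "\<And>n. norm (v n - Q n) \<le> K * s ^ n" by metis
  have vD: "v n \<in> Dl R" for n using teq_Dl[OF v(1)] D by blast
  have "(\<lambda>n. (1 + CF) * K * s ^ n) \<longlonglongrightarrow> (1 + CF) * K * 0"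
    using s by (intro tendsto_intros LIMSEQ_realpow_zero) auto
  then have "\<forall>\<^sub>F n in sequentially. (1 + CF) * K * s ^ n < 1 / 2"
    by (intro order_tendstoD) auto
  \<comment> \<open>From \<open>n0\<close> on, \<open>F (v n)\<close> and \<open>v (Suc n)\<close>
    are both within 1/2 of \<open>Q (Suc n)\<close>. As lifts of one point they agree, so the
    separately chosen \<open>v n\<close> form an orbit.\<close>
  then obtain n0 where n0: "\<And>n. n \<ge> n0 \<Longrightarrow> (1 + CF) * (K * s ^ n) < 1 / 2"
    unfolding eventually_sequentially by (auto simp: mult.assoc)
  have small: "K * s ^ n < 1 / 2" "CF * (K * s ^ n) < 1 / 2" if "n \<ge> n0" for n
  proof -
    have "0 \<le> K * s ^ n" using K s by simp
    moreover from this have "0 \<le> CF * (K * s ^ n)" using CF_nonneg by simp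
    ultimately show "K * s ^ n < 1 / 2" "CF * (K * s ^ n) < 1 / 2"
      using n0[OF that] by (auto simp: distrib_right)
  qed
  have lam_le: "norm (lam a - lam b) \<le> norm (a - b)" for a b :: "('c, 'u, 's) pt"
    using norm_proj_le(1,3)[of "a - b"] by simp
  define d where "d n = norm (lx (v n) - lx (Q n))" for n
  have grow: "0 < d n \<and> \<xi> * d n \<le> d (Suc n)" if n: "n \<ge> n0" for n
  proof -
    have Fv: "norm (F (v n) - Q (Suc n)) < 1 / 2"
      using F_lipschitz[OF vD[of n] D(2)[of n]] v(2)[of n] small(2)[OF n] CF_nonneg
      by (smt (verit) mult_left_mono step(2))
    have "norm (v (Suc n) - Q (Suc n)) < 1 / 2" using v(2)[of "Suc n"] small(1)[of "Suc n"] n by linarith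
    with Fv have "norm (lam (F (v n)) - lam (v (Suc n))) < 1"
      using lam_le[of "F (v n)" "v (Suc n)"] norm_triangle_ineq4[of "F (v n) - Q (Suc n)" "v (Suc n) - Q (Suc n)"] by simp
    moreover have "teq (F (v n)) (v (Suc n))"
      using F_teq[OF vD v(1), of n] v(1)[of "Suc n"] step(1) by (metis teq_sym teq_trans)
    ultimately have eq: "F (v n) = v (Suc n)" using teq_close by blast
    have l: "norm (lam (v n) - lam (Q n)) \<le> RLam"
      using lam_le[of "v n" "Q n"] v(2)[of n] small(1)[OF n] by (simp add: RLam_def)
    have "v n \<notin> Js (Q n) (1 / L)" using out[of n] Js_teq[OF v(1)] by blast
    then have "v n \<notin> Js_chart (Q n) (1 / L)" unfolding Js_iff using teq_refl by blast
    then have y: "1 / L * norm (yc (v n) - yc (Q n)) < d n" using l by (simp add: Js_chart_def d_def)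
    then have "0 < d n" using L_pos by (smt (verit) divide_nonneg_nonneg mult_nonneg_nonneg norm_ge_zero)
    moreover have "norm (yc (v n) - yc (Q n)) \<le> L * d n" using y L_pos by (simp add: field_simps)
    then have "sup_dyflx * norm (yc (v n) - yc (Q n)) \<le> sup_dyflx * (L * d n)" using sup_dyflx_nonneg by (rule mult_left_mono)
    then have "\<xi> * d n \<le> d (Suc n)"
      using lx_estimate[OF vD D(2) l] unfolding eq step(2)[symmetric] d_def[symmetric] \<xi>_def
      by (simp add: algebra_simps)
    ultimately show ?thesis ..
  qed
  have pow: "\<xi> ^ j * d n0 \<le> d (n0 + j)" for j
  proof (induction j)
    case (Suc j)
    have "\<xi> ^ Suc j * d n0 \<le> \<xi> * d (n0 + j)" using Suc s by (simp add: mult_left_mono mult.assoc)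
    then show ?case using grow[of "n0 + j"] by simp
  qed simp
  have "d n0 \<le> K * s ^ n0 * (s / \<xi>) ^ j" for j
  proof -
    have "\<xi> ^ j * d n0 \<le> K * s ^ (n0 + j)"
      using pow[of j] v(2)[of "n0 + j"] norm_proj_le(1)[of "v (n0 + j) - Q (n0 + j)"] by (simp add: d_def)
    then show ?thesis using s by (simp add: power_divide power_add field_simps)
  qed
  moreover have "(\<lambda>j. K * s ^ n0 * (s / \<xi>) ^ j) \<longlonglongrightarrow> K * s ^ n0 * 0"
    using s by (intro tendsto_intros LIMSEQ_realpow_zero) auto
  ultimately have "d n0 \<le> 0" by (metis LIMSEQ_le_const mult_zero_right)
  then show False using grow[of n0] by simp
qed

section \<open>The fibre as a graph over the y-ball\<close>

lemma Ws_teq: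
  assumes p: "p \<in> Ws R L F z" and pq: "teq p q"
  shows "q \<in> Ws R L F z"
proof -
  have D: "(F ^^ n) p \<in> Dl R" and J: "(F ^^ n) p \<in> Js ((F ^^ n) z) (1 / L)" for n using p by (auto simp: Ws_def)
  have t: "teq ((F ^^ n) p) ((F ^^ n) q)" for n by (rule funpow_teq[OF D pq])
  have "(F ^^ n) q \<in> Dl R" "(F ^^ n) q \<in> Js ((F ^^ n) z) (1 / L)" for n
    using D J teq_Dl[OF t] Js_teq[OF t] by blast+
  then show ?thesis unfolding Ws_def using teq_Dl[OF pq] D[of 0] by auto
qed

lemma tdist_le:
  assumes "teq (pt_of a1 y1) (pt_of b1 y1)" "teq (pt_of a2 y2) (pt_of b2 y2)"
  shows "tdist b1 b2 \<le> norm (a1 - a2)"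
proof -
  define n where "n = (fst a1 - fst b1) - (fst a2 - fst b2)"
  have "intvec n" using assms by (auto simp: teq_def n_def intro: intvec_diff)
  moreover have "a1 - a2 = (fst b1 - fst b2 + n, snd b1 - snd b2)"
    using assms by (simp add: teq_def n_def prod_eq_iff)
  ultimately show ?thesis
    unfolding tdist_def by (intro cInf_lower bdd_belowI[of _ 0]) auto
qed

theorem stable_fiber_Lipschitz:
  assumes z: "z \<in> Wcs R F"
  shows "\<exists>w :: real^'s \<Rightarrow> (real^'c) \<times> (real^'u).
     (\<forall>p. p \<in> Ws R L F z \<longleftrightarrow> yc p \<in> cball 0 R \<and> teq p (fst (w (yc p)), snd (w (yc p)), yc p)) \<and>
     (\<forall>y1\<in>cball 0 R. \<forall>y2\<in>cball 0 R. tdist (w y1) (w y2) \<le> M * norm (y1 - y2))"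
proof -
  have "\<exists>a. pt_of a y \<in> Ws R L F z" if "y \<in> cball 0 R" for y
    using Ws_pair_exists[OF z that that] by blast
  then obtain w where w: "\<And>y. y \<in> cball 0 R \<Longrightarrow> pt_of (w y) y \<in> Ws R L F z" by metis
  have "p \<in> Ws R L F z \<longleftrightarrow> yc p \<in> cball 0 R \<and> teq p (pt_of (w (yc p)) (yc p))" for p
  proof
    assume p: "p \<in> Ws R L F z"
    then have "yc p \<in> cball 0 R" by (simp add: Ws_def mem_Dl)
    then show "yc p \<in> cball 0 R \<and> teq p (pt_of (w (yc p)) (yc p))"
      using Ws_unique[OF z p w] by simp
  next
    assume "yc p \<in> cball 0 R \<and> teq p (pt_of (w (yc p)) (yc p))"
    then show "p \<in> Ws R L F z" using w Ws_teq teq_sym by blast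
  qed
  moreover have "tdist (w y1) (w y2) \<le> M * norm (y1 - y2)" if y: "y1 \<in> cball 0 R" "y2 \<in> cball 0 R" for y1 y2
  proof -
    \<comment> \<open>\<open>w\<close> was chosen over each y separately and carries no bound. The
      pair \<open>a1\<close>, \<open>a2\<close> does, and uniqueness identifies it with the values
      of \<open>w\<close> modulo integers.\<close>
    obtain a1 a2 where a: "pt_of a1 y1 \<in> Ws R L F z" "pt_of a2 y2 \<in> Ws R L F z" "norm (a1 - a2) \<le> M * norm (y1 - y2)"
      using Ws_pair_exists[OF z y] by metis
    have "teq (pt_of a1 y1) (pt_of (w y1) y1)" "teq (pt_of a2 y2) (pt_of (w y2) y2)"
      using Ws_unique[OF z a(1) w[OF y(1)]] Ws_unique[OF z a(2) w[OF y(2)]] by auto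
    then show ?thesis using tdist_le a(3) order_trans by blast
  qed
  ultimately show ?thesis unfolding pt_of_def by blast
qed

end

theorem theorem3p2:
  fixes F :: "(real^'c::finite) \<times> (real^'u::finite) \<times> (real^'s::finite)
              \<Rightarrow> (real^'c) \<times> (real^'u) \<times> (real^'s)"
    and k :: nat and R L M :: real
  assumes R_pos: "0 < R" and R_small: "R < RLam / 2"
    and L_range: "2 * R / RLam < L" "L < 1"
    and k_ge: "k \<ge> 1"
    and lift: "is_lift_map R F"
    and smooth: "\<exists>S. Dl R \<subseteq> S \<and> Ck_on (k + 1) F S"
    and cover: "covering_conditions R L F"
    and rate: "rate_conditions k R L F"
    and bcone: "backward_cone_conditions R L F"
    and M_range: "0 < M" "M < 1 / L"
    and ratio: "(infD R (\<lambda>z. m_set (ivmat (dlxflx F) (Pset R z)))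
                   - 1 / M * supD R (\<lambda>p. onorm (dyflx F p)))
               / supD R (\<lambda>p. onorm (dyfy F p) + M * onorm (dlxfy F p)) > 1"
  shows "\<forall>z\<in>Wcs R F. \<exists>w :: real^'s \<Rightarrow> (real^'c) \<times> (real^'u).
            (\<forall>p. p \<in> Ws R L F z \<longleftrightarrow> yc p \<in> cball 0 R \<and> teq p (fst (w (yc p)), snd (w (yc p)), yc p)) \<and>
            (\<forall>y1\<in>cball 0 R. \<forall>y2\<in>cball 0 R. tdist (w y1) (w y2) \<le> M * norm (y1 - y2))"
proof -
  obtain S where "Dl R \<subseteq> S" "Ck_on (k + 1) F S" using smooth by blast
  then interpret stable_fibers F R S L M k
    using assms by unfold_locales (auto elim: Ck_on_mono)
  show ?thesis using stable_fiber_Lipschitz by blast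
qed

end
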